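(* Let $N\ge2$, let $1<p<\infty$, let $b^-<b^+$ be real constants, and let $\Omega=\{x\in\mathbb{R}^N : b^-<x_N<b^+\}$. Then there exists a function $u\in\dot{W}^{1,p}(\Omega)$ such that $u$ cannot be extended to a function in $\dot{W}^{1,p}(\mathbb{R}^N)$. In particular, there does not exist a bounded extension operator $E:\dot{W}^{1,p}(\Omega)\to\dot{W}^{1,p}(\mathbb{R}^N)$.
   Context: For an open set $\Omega\subseteq\mathbb{R}^N$, $\dot{W}^{1,p}(\Omega)$ is the space of real-valued $u\in L^1_{\mathrm{loc}}(\Omega)$ whose first-order weak derivatives all belong to $L^p(\Omega)$, with seminorm $\|\nabla u\|_{L^p(\Omega)}$. An extension of $u$ is a function $v$ on $\mathbb{R}^N$ with $v=u$ a.e. in $\Omega$. *)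

theory Defs
  imports "HOL-Analysis.Analysis"
begin

text \<open>
  Functions on an open set \<open>\<Omega>\<close> are represented by total functions of which only the values
  on \<open>\<Omega>\<close> matter; functions that agree almost everywhere are not identified.
\<close>

definition partial_deriv :: "'n \<Rightarrow> (real ^ 'n \<Rightarrow> real) \<Rightarrow> real ^ 'n \<Rightarrow> real" where
  "partial_deriv i \<phi> x = frechet_derivative \<phi> (at x) (axis i 1)"

primrec C_k :: "nat \<Rightarrow> (real ^ 'n \<Rightarrow> real) \<Rightarrow> bool" where
  "C_k 0 \<phi> \<longleftrightarrow> continuous_on UNIV \<phi>"
| "C_k (Suc k) \<phi> \<longleftrightarrow> (\<forall>x. \<phi> differentiable (at x)) \<and> (\<forall>i. C_k k (partial_deriv i \<phi>))"

definition test_functions :: "(real ^ 'n) set \<Rightarrow> (real ^ 'n \<Rightarrow> real) set" where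
  "test_functions \<Omega> =
     {\<phi>. (\<forall>k. C_k k \<phi>) \<and> compact (closure {x. \<phi> x \<noteq> 0}) \<and> closure {x. \<phi> x \<noteq> 0} \<subseteq> \<Omega>}"

text \<open>Integrability on compact sets already entails measurability on the open set \<open>\<Omega>\<close>.\<close>

definition L1_loc :: "(real ^ 'n) set \<Rightarrow> (real ^ 'n \<Rightarrow> real) set" where
  "L1_loc \<Omega> = {u. \<forall>K. compact K \<and> K \<subseteq> \<Omega> \<longrightarrow> set_integrable lebesgue K u}"

definition Lp_space :: "real \<Rightarrow> (real ^ 'n) set \<Rightarrow> (real ^ 'n \<Rightarrow> real) set" where
  "Lp_space p \<Omega> =
     {f. set_borel_measurable lebesgue \<Omega> f \<and> set_integrable lebesgue \<Omega> (\<lambda>x. \<bar>f x\<bar> powr p)}"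

definition weak_partial_deriv ::
    "(real ^ 'n) set \<Rightarrow> 'n \<Rightarrow> (real ^ 'n \<Rightarrow> real) \<Rightarrow> (real ^ 'n \<Rightarrow> real) \<Rightarrow> bool" where
  "weak_partial_deriv \<Omega> i u g \<longleftrightarrow>
     g \<in> L1_loc \<Omega> \<and>
     (\<forall>\<phi>\<in>test_functions \<Omega>.
        (LINT x:\<Omega>|lebesgue. u x * partial_deriv i \<phi> x) = - (LINT x:\<Omega>|lebesgue. g x * \<phi> x))"

definition weak_gradient ::
    "(real ^ 'n) set \<Rightarrow> (real ^ 'n \<Rightarrow> real) \<Rightarrow> (real ^ 'n \<Rightarrow> real ^ 'n) \<Rightarrow> bool" where
  "weak_gradient \<Omega> u G \<longleftrightarrow> (\<forall>i. weak_partial_deriv \<Omega> i u (\<lambda>x. G x $ i))"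

definition homogeneous_sobolev :: "real \<Rightarrow> (real ^ 'n) set \<Rightarrow> (real ^ 'n \<Rightarrow> real) set" where
  "homogeneous_sobolev p \<Omega> =
     {u \<in> L1_loc \<Omega>. \<exists>G. weak_gradient \<Omega> u G \<and> (\<forall>i. (\<lambda>x. G x $ i) \<in> Lp_space p \<Omega>)}"

text \<open>
  Weak gradients are unique up to a null subset of \<open>\<Omega>\<close>, so the choice made below does not
  affect the seminorm. It is meaningful only on \<open>homogeneous_sobolev p \<Omega>\<close>.
\<close>

definition sobolev_seminorm :: "real \<Rightarrow> (real ^ 'n) set \<Rightarrow> (real ^ 'n \<Rightarrow> real) \<Rightarrow> real" where
  "sobolev_seminorm p \<Omega> u =
     (LINT x:\<Omega>|lebesgue. norm ((SOME G. weak_gradient \<Omega> u G) x) powr p) powr (1 / p)"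

definition is_extension ::
    "(real ^ 'n) set \<Rightarrow> (real ^ 'n \<Rightarrow> real) \<Rightarrow> (real ^ 'n \<Rightarrow> real) \<Rightarrow> bool" where
  "is_extension \<Omega> u v \<longleftrightarrow> (AE x in lebesgue. x \<in> \<Omega> \<longrightarrow> v x = u x)"

text \<open>
  Linearity of \<open>E\<close> is not required, nor that \<open>E\<close> respect equality almost everywhere; this makes
  the nonexistence of such an \<open>E\<close> the stronger assertion.
\<close>

definition bounded_extension_operator ::
    "real \<Rightarrow> (real ^ 'n) set \<Rightarrow> ((real ^ 'n \<Rightarrow> real) \<Rightarrow> (real ^ 'n \<Rightarrow> real)) \<Rightarrow> bool" where
  "bounded_extension_operator p \<Omega> E \<longleftrightarrow>
     (\<forall>u\<in>homogeneous_sobolev p \<Omega>.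
        E u \<in> homogeneous_sobolev p UNIV \<and> is_extension \<Omega> u (E u)) \<and>
     (\<exists>C. \<forall>u\<in>homogeneous_sobolev p \<Omega>.
        sobolev_seminorm p UNIV (E u) \<le> C * sobolev_seminorm p \<Omega> u)"

definition strip :: "'n \<Rightarrow> real \<Rightarrow> real \<Rightarrow> (real ^ 'n) set" where
  "strip k a b = {x. a < x $ k \<and> x $ k < b}"

end

theory Submission
  imports Defs "HOL-Computational_Algebra.Polynomial"
begin

text \<open>
  Take \<open>u\<close> to be a power \<open>Q powr (\<alpha> / 2) / \<alpha>\<close> of \<open>Q x = 1 + (\<Sum>i\<noteq>k. (x $ i)\<^sup>2)\<close>. Its gradient decays like
  \<open>Q powr ((\<alpha> - 1) / 2)\<close>, so it is \<open>p\<close>-integrable over the strip as soon as \<open>(1 - \<alpha>) p > N - 1\<close>.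
  Suppose \<open>u\<close> had an extension \<open>v\<close>. Let \<open>\<eta>\<close> be a bounded antiderivative of a bump function \<open>\<beta>\<close>
  supported in the interval that defines the strip, and let \<open>\<psi>\<close> be a bump function of scale \<open>R\<close>.
  The field \<open>\<eta>(x\<^sub>k) (\<partial>\<^sub>j\<psi> e\<^sub>k - \<partial>\<^sub>k\<psi> e\<^sub>j)\<close> extends over a ball of radius \<open>R\<close>, but its divergence
  \<open>\<beta>(x\<^sub>k) \<partial>\<^sub>j\<psi>\<close> lives in the strip, where \<open>v = u\<close>. Pairing it with the gradient of \<open>v\<close> gives at most
  \<open>O(R powr (N - N / p - 1))\<close>, whereas the divergence paired with \<open>u\<close> grows at least like
  \<open>R powr (N + \<alpha> - 2)\<close>. For \<open>(1 - \<alpha>) p < N\<close> this is a contradiction.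
\<close>

subsection \<open>Smooth functions\<close>

text \<open>The classical smooth function \<open>exp (- (1 / t))\<close> glued to zero, with a
  polynomial factor in \<open>1 / t\<close>. The factor makes the family closed under
  differentiation, so one derivative formula yields smoothness of every order.\<close>

definition flat :: "real poly \<Rightarrow> real \<Rightarrow> real" where
  "flat P t = (if t \<le> 0 then 0 else poly P (1 / t) * exp (- (1 / t)))"

text \<open>With \<open>s = 1 / t\<close>, the \<open>t\<close>-derivative of
  \<open>P s * exp (- s)\<close> is \<open>s\<^sup>2 * (P s - P' s) * exp (- s)\<close>; the
  coefficient list is the monomial \<open>s\<^sup>2\<close>.\<close>

definition flat_step :: "real poly \<Rightarrow> real poly" where
  "flat_step P = [:0, 0, 1:] * (P - pderiv P)"

lemma tendsto_poly_exp_minus: "((\<lambda>x::real. poly P x * exp (- x)) \<longlongrightarrow> 0) at_top"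
proof -
  have "((\<lambda>x::real. \<Sum>i\<le>degree P. coeff P i * (x ^ i / exp x)) \<longlongrightarrow> (\<Sum>i\<le>degree P. coeff P i * 0)) at_top"
    by (intro tendsto_sum tendsto_mult tendsto_const tendsto_power_div_exp_0)
  then show ?thesis
    by (simp add: poly_altdef exp_minus field_simps sum_distrib_left)
qed

lemma flat_has_derivative: "(flat P has_real_derivative flat (flat_step P) t) (at t)"
proof -
  consider "t < 0" | "t > 0" | "t = 0" by linarith
  then show ?thesis
  proof cases
    case 1
    have "((\<lambda>_. 0) has_real_derivative flat (flat_step P) t) (at t)"
      using 1 by (simp add: flat_def)
    then show ?thesis
      by (rule DERIV_cong_ev[OF refl _ refl, THEN iffD2, rotated])
        (use 1 in \<open>auto simp: flat_def intro: eventually_nhds_in_open[THEN eventually_mono, of "{..<0}"]\<close>)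
  next
    case 2
    have "((\<lambda>t. poly P (1 / t) * exp (- (1 / t))) has_real_derivative flat (flat_step P) t) (at t)"
      using 2 by (auto intro!: derivative_eq_intros DERIV_chain2[OF poly_DERIV] simp: flat_def flat_step_def field_simps power2_eq_square)
    then show ?thesis
      by (rule DERIV_cong_ev[OF refl _ refl, THEN iffD2, rotated])
        (use 2 in \<open>auto simp: flat_def intro: eventually_nhds_in_open[THEN eventually_mono, of "{0<..}"]\<close>)
  next
    case 3
    \<comment> \<open>The difference quotient at 0 brings one more factor \<open>1 / h\<close>;
      \<open>pCons 0 P\<close>, the product of \<open>P\<close> with the indeterminate, absorbs
      it.\<close>
    have "((\<lambda>h. poly (pCons 0 P) (inverse h) * exp (- inverse h)) \<longlongrightarrow> 0) (at_right (0::real))"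
      using filterlim_compose[OF tendsto_poly_exp_minus filterlim_inverse_at_top_right, of "pCons 0 P"] .
    then have "((\<lambda>h. flat P h / h) \<longlongrightarrow> 0) (at_right 0)"
      by (rule Lim_transform_eventually)
        (auto simp: flat_def field_simps eventually_at_filter)
    moreover have "((\<lambda>h. flat P h / h) \<longlongrightarrow> 0) (at_left 0)"
      by (rule Lim_transform_eventually[OF tendsto_const])
        (auto simp: flat_def eventually_at_filter)
    ultimately have "((\<lambda>h. flat P h / h) \<longlongrightarrow> 0) (at 0)"
      by (simp add: filterlim_split_at_real)
    then show ?thesis
      using 3 by (simp add: DERIV_def flat_def)
  qed
qed

lemma continuous_on_flat [continuous_intros]:
  "continuous_on S f \<Longrightarrow> continuous_on S (\<lambda>x. flat P (f x))"
  by (rule continuous_on_compose2[of UNIV])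
    (auto intro: DERIV_continuous_on flat_has_derivative)

section \<open>Stability of smoothness under algebraic operations and composition\<close>

lemma partial_deriv_eqI:
  "(f has_derivative f') (at x) \<Longrightarrow> partial_deriv i f x = f' (axis i 1)"
  by (simp add: partial_deriv_def frechet_derivative_at[symmetric])

lemma partial_deriv_add:
  assumes "f differentiable (at x)" "g differentiable (at x)"
  shows "partial_deriv i (\<lambda>x. f x + g x) x = partial_deriv i f x + partial_deriv i g x"
  using partial_deriv_eqI[OF has_derivative_add[OF assms[unfolded frechet_derivative_works]]]
  by (simp add: partial_deriv_def)

lemma partial_deriv_mult:
  assumes "f differentiable (at x)" "g differentiable (at x)"
  shows "partial_deriv i (\<lambda>x. f x * g x) x = f x * partial_deriv i g x + partial_deriv i f x * g x"
  using partial_deriv_eqI[OF has_derivative_mult[OF assms[unfolded frechet_derivative_works]]]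
  by (simp add: partial_deriv_def)

lemma C_k_SucI:
  assumes "\<And>x. f differentiable (at x)" "\<And>i x. partial_deriv i f x = f' i x" "\<And>i. C_k k (f' i)"
  shows "C_k (Suc k) f"
proof -
  have "partial_deriv i f = f' i" for i
    using assms(2) by auto
  then show ?thesis using assms by simp
qed

text \<open>Product and chain rules mix a function with its own derivatives, so in inductions the
  function itself must also be available at the lower order.\<close>

lemma C_k_Suc_imp: "C_k (Suc k) f \<Longrightarrow> C_k k f"
proof (induction k arbitrary: f)
  case 0
  then show ?case
    by (auto simp: continuous_on_eq_continuous_at intro: differentiable_imp_continuous_within)
next
  case (Suc k)
  then show ?case by (metis C_k.simps(2))
qed

lemma C_k_const: "C_k k (\<lambda>x. c)"
  by (induction k arbitrary: c)
    (auto intro!: C_k_SucI[where f' = "\<lambda>_ _. 0"] simp: partial_deriv_eqI[OF has_derivative_const] simp del: C_k.simps(2))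

lemma C_k_add: "C_k k f \<Longrightarrow> C_k k g \<Longrightarrow> C_k k (\<lambda>x. f x + g x)"
proof (induction k arbitrary: f g)
  case (Suc k)
  then have d: "f differentiable (at x)" "g differentiable (at x)" for x by auto
  show ?case
  proof (rule C_k_SucI)
    show "partial_deriv i (\<lambda>x. f x + g x) x = partial_deriv i f x + partial_deriv i g x" for i x
      using d by (simp add: partial_deriv_add)
    show "C_k k (\<lambda>x. partial_deriv i f x + partial_deriv i g x)" for i
      using Suc by (intro Suc.IH) auto
  qed (use d in auto)
qed (auto intro: continuous_intros)

lemma C_k_mult: "C_k k f \<Longrightarrow> C_k k g \<Longrightarrow> C_k k (\<lambda>x. f x * g x)"
proof (induction k arbitrary: f g)
  case (Suc k)
  then have d: "f differentiable (at x)" "g differentiable (at x)" for x by auto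
  show ?case
  proof (rule C_k_SucI)
    show "partial_deriv i (\<lambda>x. f x * g x) x = f x * partial_deriv i g x + partial_deriv i f x * g x" for i x
      using d by (simp add: partial_deriv_mult)
    show "C_k k (\<lambda>x. f x * partial_deriv i g x + partial_deriv i f x * g x)" for i
      using Suc C_k_Suc_imp[of k f] C_k_Suc_imp[of k g]
      by (intro C_k_add Suc.IH) auto
  qed (use d in auto)
qed (auto intro: continuous_intros)

lemma has_derivative_component: "((\<lambda>x::real^'n. x $ i) has_derivative (\<lambda>x. x $ i)) (at x)"
  by (intro bounded_linear_imp_has_derivative bounded_linear_vec_nth)

lemma C_k_component: "C_k k (\<lambda>x. x $ i)"
proof (cases k)
  case (Suc k)
  show ?thesis unfolding Suc
    by (rule C_k_SucI[where f' = "\<lambda>j _. axis j 1 $ i"])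
      (auto simp: partial_deriv_eqI[OF has_derivative_component] C_k_const intro: differentiableI[OF has_derivative_component])
qed (auto intro: continuous_intros)

lemma C_k_sum: "finite S \<Longrightarrow> (\<And>i. i \<in> S \<Longrightarrow> C_k k (f i)) \<Longrightarrow> C_k k (\<lambda>x. \<Sum>i\<in>S. f i x)"
  by (induction S rule: finite_induct) (auto intro!: C_k_const C_k_add)

text \<open>\<open>P\<close> stays arbitrary in the induction because each derivative replaces it by
  \<open>flat_step P\<close>, times a partial derivative of \<open>f\<close> of lower order.\<close>

lemma C_k_comp_flat: "C_k k f \<Longrightarrow> C_k k (\<lambda>x. flat P (f x))"
proof (induction k arbitrary: P)
  case (Suc k)
  have f: "(f has_derivative frechet_derivative f (at x)) (at x)" for x
    using Suc.prems by (auto simp: frechet_derivative_works)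
  have d: "((\<lambda>x. flat P (f x)) has_derivative (\<lambda>h. flat (flat_step P) (f x) * frechet_derivative f (at x) h)) (at x)" for x
    using has_derivative_compose[OF f flat_has_derivative[unfolded has_field_derivative_def]] .
  show ?case
  proof (rule C_k_SucI)
    show "partial_deriv i (\<lambda>x. flat P (f x)) x = flat (flat_step P) (f x) * partial_deriv i f x" for i x
      using partial_deriv_eqI[OF d] by (simp add: partial_deriv_def)
    show "C_k k (\<lambda>x. flat (flat_step P) (f x) * partial_deriv i f x)" for i
      using Suc C_k_Suc_imp[of k f] by (intro C_k_mult Suc.IH) auto
  qed (use d in \<open>auto simp: differentiable_def\<close>)
qed (auto intro: continuous_intros)

text \<open>The partial derivatives of \<open>F (x $ i)\<close> are \<open>f (x $ i)\<close> or
  zero, smooth by assumption. This admits the antiderivative \<open>\<eta>\<close> of a bump, which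
  has no explicit formula, into test functions.\<close>

lemma C_k_antiderivative_component:
  assumes "\<And>t. (F has_real_derivative f t) (at t)" "\<And>k. C_k k (\<lambda>x. f (x $ i))"
  shows "C_k k (\<lambda>x. F (x $ i))"
proof (cases k)
  case 0
  have "continuous_on UNIV F"
    using assms(1) by (intro DERIV_continuous_on) auto
  then show ?thesis
    using 0 by (auto intro!: continuous_on_compose2[of UNIV F] continuous_intros)
next
  case (Suc k)
  have d: "((\<lambda>x. F (x $ i)) has_derivative (\<lambda>h. f (x $ i) * (h $ i))) (at x)" for x
    using has_derivative_compose[OF has_derivative_component assms(1)[unfolded has_field_derivative_def]] .
  show ?thesis unfolding Suc
    by (rule C_k_SucI[where f' = "\<lambda>j x. f (x $ i) * axis j 1 $ i"])
      (auto simp: partial_deriv_eqI[OF d] intro!: C_k_mult C_k_const assms(2) differentiableI[OF d])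
qed

subsection \<open>Integration by parts\<close>

lemma partial_deriv_eq_0:
  assumes "closed K" "\<And>x. x \<notin> K \<Longrightarrow> \<phi> x = 0" "x \<notin> K"
  shows "partial_deriv i \<phi> x = 0"
proof -
  have "((\<lambda>_. 0) has_derivative (\<lambda>_. 0)) (at x)" by simp
  then have "(\<phi> has_derivative (\<lambda>_. 0)) (at x)"
    by (rule has_derivative_transform_within_open[of _ _ _ _ "- K"]) (use assms in auto)
  then show ?thesis by (simp add: partial_deriv_eqI)
qed

lemma continuous_compact_support_integrable:
  fixes h :: "real ^ 'n \<Rightarrow> real"
  assumes "continuous_on UNIV h" "compact K" "\<And>x. x \<notin> K \<Longrightarrow> h x = 0"
  shows "integrable lborel h"
proof -
  have "integrable lborel (\<lambda>x. indicator K x *\<^sub>R h x)"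
    using assms by (intro borel_integrable_compact) (auto intro: continuous_on_subset)
  also have "(\<lambda>x. indicator K x *\<^sub>R h x) = h"
    using assms(3) by (intro ext) (auto simp: indicator_def)
  finally show ?thesis .
qed

text \<open>By translation invariance every difference quotient of \<open>h\<close> has integral
  zero; dominated convergence passes this to the derivative.\<close>

lemma integral_partial_deriv_eq_0:
  fixes h :: "real ^ 'n \<Rightarrow> real"
  assumes h: "\<And>x. h differentiable (at x)" and c: "continuous_on UNIV (partial_deriv i h)"
    and K: "compact K" "\<And>x. x \<notin> K \<Longrightarrow> h x = 0"
  shows "(LINT x|lborel. partial_deriv i h x) = 0"
proof -
  define e :: "real ^ 'n" where "e = axis i 1"
  obtain b where b: "\<And>x. x \<in> K \<Longrightarrow> norm x \<le> b"
    using compact_imp_bounded[OF K(1)] by (auto simp: bounded_iff)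
  \<comment> \<open>The radius has two unit margins: one for points whose translate may still meet
    \<open>K\<close>, one for the intermediate point of the mean value theorem.\<close>
  have "bounded (partial_deriv i h ` cball 0 (b + 2))"
    by (intro compact_imp_bounded compact_continuous_image) (auto intro: continuous_on_subset[OF c])
  then obtain M where M: "\<And>x. norm x \<le> b + 2 \<Longrightarrow> \<bar>partial_deriv i h x\<bar> \<le> M"
    unfolding bounded_iff by (metis image_eqI mem_cball_0 real_norm_def)
  have ch: "continuous_on UNIV h"
    using h by (simp add: continuous_on_eq_continuous_at differentiable_imp_continuous_within)
  have int: "integrable lborel h"
    using continuous_compact_support_integrable[OF ch K] by simp
  define t :: "nat \<Rightarrow> real" where "t n = 1 / real (Suc n)" for n
  have t: "0 < t n" "t n \<le> 1" for n by (auto simp: t_def field_simps)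
  have dt: "((\<lambda>s. h (x + s *\<^sub>R e)) has_real_derivative partial_deriv i h (x + s *\<^sub>R e)) (at s)" for x s
  proof -
    have 1: "(h has_derivative frechet_derivative h (at (x + s *\<^sub>R e))) (at (x + s *\<^sub>R e))"
      using h frechet_derivative_works by blast
    have "((\<lambda>s. h (x + s *\<^sub>R e)) has_derivative (\<lambda>r. frechet_derivative h (at (x + s *\<^sub>R e)) (r *\<^sub>R e))) (at s)"
      by (rule has_derivative_compose[where f = "\<lambda>s. x + s *\<^sub>R e", OF _ 1]) (auto intro!: derivative_eq_intros)
    also have "(\<lambda>r. frechet_derivative h (at (x + s *\<^sub>R e)) (r *\<^sub>R e)) = (*) (partial_deriv i h (x + s *\<^sub>R e))"
      using linear_frechet_derivative[OF h] by (auto simp: linear_scale partial_deriv_def e_def)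
    finally show ?thesis by (simp add: has_field_derivative_def)
  qed
  define D where "D n x = (h (x + t n *\<^sub>R e) - h x) / t n" for n x
  have "(\<lambda>n. LINT x|lborel. D n x) \<longlonglongrightarrow> (LINT x|lborel. partial_deriv i h x)"
  proof (rule integral_dominated_convergence)
    \<comment> \<open>Beyond radius \<open>b + 1\<close> both \<open>x\<close> and its translate, at
      distance at most 1, miss \<open>K\<close>; inside, the mean value theorem bounds the quotient
      by \<open>M\<close>.\<close>
    show "integrable lborel (\<lambda>x. M * indicator (cball 0 (b + 1) :: (real^'n) set) x)"
      using emeasure_lborel_cball_finite[of "0::real^'n" "b+1"] by auto
    show "AE x in lborel. (\<lambda>n. D n x) \<longlonglongrightarrow> partial_deriv i h x"
    proof (rule AE_I2)
      fix x
      have "((\<lambda>s. (h (x + s *\<^sub>R e) - h x) / s) \<longlongrightarrow> partial_deriv i h x) (at 0)"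
        using dt[of x 0] by (simp add: DERIV_def)
      moreover have "filterlim t (at 0) sequentially"
        unfolding filterlim_at using t(1) LIMSEQ_inverse_real_of_nat
        by (auto simp: t_def[abs_def] inverse_eq_divide)
      ultimately show "(\<lambda>n. D n x) \<longlonglongrightarrow> partial_deriv i h x"
        unfolding D_def by (rule filterlim_compose)
    qed
    show "AE x in lborel. norm (D n x) \<le> M * indicator (cball 0 (b + 1)) x" for n
    proof (rule AE_I2)
      fix x
      have ne: "norm e = 1" by (simp add: e_def)
      show "norm (D n x) \<le> M * indicator (cball 0 (b + 1)) x"
      proof (cases "norm x \<le> b + 1")
        case True
        obtain z where z: "0 < z" "z < t n"
          "h (x + t n *\<^sub>R e) - h (x + 0 *\<^sub>R e) = (t n - 0) * partial_deriv i h (x + z *\<^sub>R e)"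
          using MVT2[OF t(1)[of n], of "\<lambda>s. h (x + s *\<^sub>R e)" "\<lambda>s. partial_deriv i h (x + s *\<^sub>R e)"] dt by blast
        have "norm (x + z *\<^sub>R e) \<le> b + 2"
          using norm_triangle_ineq[of x "z *\<^sub>R e"] True z t(2)[of n] ne by auto
        then show ?thesis using M[of "x + z *\<^sub>R e"] z t(1)[of n] True by (simp add: D_def)
      next
        case False
        have "norm (x + t n *\<^sub>R e) > b"
          using norm_triangle_ineq2[of x "- (t n *\<^sub>R e)"] False t[of n] ne by auto
        then have "h x = 0" "h (x + t n *\<^sub>R e) = 0"
          using b K(2) False by (smt (verit))+
        then show ?thesis using False by (simp add: D_def)
      qed
    qed
  qed (use c ch in \<open>auto simp: D_def less_imp_neq[OF t(1), symmetric] intro!: borel_measurable_continuous_onI continuous_intros continuous_on_compose2[OF ch]\<close>)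
  moreover have "(LINT x|lborel. D n x) = 0" for n
  proof -
    have b: "h \<in> borel_measurable lborel" using int by auto
    have i2: "integrable lborel (\<lambda>x. h (t n *\<^sub>R e + x))"
      using int by (subst (asm) lborel_distr_plus[of "t n *\<^sub>R e", symmetric]) (use b in \<open>auto intro: integrable_distr[rotated]\<close>)
    have "(LINT x|lborel. h x) = (LINT x|distr lborel borel ((+) (t n *\<^sub>R e)). h x)"
      by (simp add: lborel_distr_plus)
    also have "\<dots> = (LINT x|lborel. h (t n *\<^sub>R e + x))"
      using b by (subst integral_distr) auto
    finally show ?thesis
      using int i2 by (simp add: D_def add.commute)
  qed
  ultimately show ?thesis
    by (simp add: LIMSEQ_const_iff)
qed

section \<open>Pairings with test functions and weak derivatives of continuously differentiable
  functions\<close>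

lemma continuous_imp_L1_loc:
  assumes "continuous_on UNIV f" shows "f \<in> L1_loc \<Omega>"
proof -
  have "set_integrable lebesgue K f" if "compact K" for K
  proof -
    have "integrable lborel (\<lambda>x. indicator K x *\<^sub>R f x)"
      using assms that by (intro borel_integrable_compact) (auto intro: continuous_on_subset)
    then show ?thesis
      by (simp add: set_integrable_def integrable_completion borel_measurable_integrable)
  qed
  then show ?thesis by (auto simp: L1_loc_def)
qed

text \<open>On \<open>K\<close> the factor \<open>\<phi>\<close> is bounded, so a multiple of
  \<open>v\<close> restricted to \<open>K\<close> dominates the product. Splitting and cancelling of
  pairings rests on this integrability.\<close>

lemma L1_loc_mult_integrable:
  fixes \<phi> :: "real ^ 'n \<Rightarrow> real"
  assumes v: "v \<in> L1_loc \<Omega>" and K: "compact K" "K \<subseteq> \<Omega>"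
    and \<phi>: "continuous_on UNIV \<phi>" "\<And>x. x \<notin> K \<Longrightarrow> \<phi> x = 0"
  shows "integrable lebesgue (\<lambda>x. v x * \<phi> x)"
proof -
  have "bounded (\<phi> ` K)"
    using K by (intro compact_imp_bounded compact_continuous_image continuous_on_subset[OF \<phi>(1)]) auto
  then obtain M where M: "\<And>x. x \<in> K \<Longrightarrow> \<bar>\<phi> x\<bar> \<le> M" by (auto simp: bounded_iff)
  have i: "integrable lebesgue (\<lambda>x. indicator K x *\<^sub>R v x)"
    using v K by (auto simp: L1_loc_def set_integrable_def)
  have eq: "(\<lambda>x. v x * \<phi> x) = (\<lambda>x. (indicator K x *\<^sub>R v x) * \<phi> x)"
    using \<phi>(2) by (intro ext) (auto simp: indicator_def)
  have "\<phi> \<in> borel_measurable lebesgue"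
    using \<phi>(1) by (intro measurable_completion) (simp add: borel_measurable_continuous_onI)
  moreover have "norm ((indicator K x *\<^sub>R v x) * \<phi> x) \<le> norm (M * (indicator K x *\<^sub>R v x))" for x
    using M[of x] mult_left_mono[of "\<bar>\<phi> x\<bar>" "\<bar>M\<bar>" "\<bar>v x\<bar>"]
    by (auto simp: indicator_def abs_mult mult.commute)
  ultimately show ?thesis
    unfolding eq using i borel_measurable_integrable[OF i]
    by (intro Bochner_Integration.integrable_bound[OF integrable_mult_right[OF i, of M]] AE_I2) auto
qed

lemma test_functionsI:
  assumes "\<And>k. C_k k \<phi>" "compact K" "K \<subseteq> \<Omega>" "\<And>x. x \<notin> K \<Longrightarrow> \<phi> x = 0"
  shows "\<phi> \<in> test_functions \<Omega>"
proof -
  have "closure {x. \<phi> x \<noteq> 0} \<subseteq> K"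
    using assms(4) by (intro closure_minimal compact_imp_closed[OF assms(2)]) auto
  moreover from this have "compact (closure {x. \<phi> x \<noteq> 0})"
    using assms(2) by (metis closed_closure compact_Int_closed inf.absorb2)
  ultimately show ?thesis using assms by (auto simp: test_functions_def)
qed

lemma set_integral_eq_integral:
  assumes "\<And>x. x \<notin> \<Omega> \<Longrightarrow> f x = 0"
  shows "(LINT x:\<Omega>|M. f x) = (LINT x|M. f x :: real)"
  unfolding set_lebesgue_integral_def
  using assms by (intro Bochner_Integration.integral_cong) (auto simp: indicator_def)

text \<open>Integrating the product rule for the compactly supported \<open>u * \<phi>\<close> over
  the whole space gives zero; since \<open>\<phi>\<close> and its derivative vanish off
  \<open>\<Omega>\<close>, the integrals over \<open>\<Omega>\<close> are the same.\<close>

lemma weak_partial_deriv_classical: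
  assumes u: "\<And>x. u differentiable (at x)" "continuous_on UNIV (partial_deriv i u)"
  shows "weak_partial_deriv \<Omega> i u (partial_deriv i u)"
  unfolding weak_partial_deriv_def
proof (intro conjI ballI)
  show "partial_deriv i u \<in> L1_loc \<Omega>"
    by (rule continuous_imp_L1_loc[OF u(2)])
  fix \<phi> assume \<phi>: "\<phi> \<in> test_functions \<Omega>"
  define K where "K = closure {x. \<phi> x \<noteq> 0}"
  have K: "compact K" "K \<subseteq> \<Omega>" and z: "\<And>x. x \<notin> K \<Longrightarrow> \<phi> x = 0"
    using \<phi> closure_subset[of "{x. \<phi> x \<noteq> 0}"] by (auto simp: test_functions_def K_def)
  have C: "C_k k \<phi>" for k using \<phi> by (auto simp: test_functions_def)
  have d: "\<phi> differentiable (at x)" and c: "continuous_on UNIV (partial_deriv i \<phi>)" for x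
    using C[of "Suc 0"] by auto
  have z': "partial_deriv i \<phi> x = 0" if "x \<notin> K" for x
    using partial_deriv_eq_0[OF compact_imp_closed[OF K(1)] z] that by auto
  have c\<phi>: "continuous_on UNIV \<phi>" using C[of 0] by simp
  have cu: "continuous_on UNIV u"
    using u(1) by (simp add: continuous_on_eq_continuous_at differentiable_imp_continuous_within)
  have i1: "integrable lebesgue (\<lambda>x. u x * partial_deriv i \<phi> x)"
    by (rule L1_loc_mult_integrable[OF continuous_imp_L1_loc[OF cu] K c z'])
  have i2: "integrable lebesgue (\<lambda>x. partial_deriv i u x * \<phi> x)"
    by (rule L1_loc_mult_integrable[OF continuous_imp_L1_loc[OF u(2)] K c\<phi> z])
  have eq: "partial_deriv i (\<lambda>x. u x * \<phi> x) = (\<lambda>x. u x * partial_deriv i \<phi> x + partial_deriv i u x * \<phi> x)"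
    using u d by (auto simp: partial_deriv_mult)
  have cc: "continuous_on UNIV (\<lambda>x. u x * partial_deriv i \<phi> x + partial_deriv i u x * \<phi> x)"
    by (intro continuous_intros cu c u c\<phi>)
  have "(LINT x|lborel. partial_deriv i (\<lambda>x. u x * \<phi> x) x) = 0"
    by (rule integral_partial_deriv_eq_0[OF _ _ K(1)]) (use u d z cc in \<open>auto simp: eq\<close>)
  then have "(LINT x|lebesgue. u x * partial_deriv i \<phi> x + partial_deriv i u x * \<phi> x) = 0"
    using cc by (simp add: eq integral_completion borel_measurable_continuous_onI)
  then have "(LINT x|lebesgue. u x * partial_deriv i \<phi> x) + (LINT x|lebesgue. partial_deriv i u x * \<phi> x) = 0"
    using i1 i2 by simp
  moreover have "x \<notin> \<Omega> \<Longrightarrow> \<phi> x = 0" "x \<notin> \<Omega> \<Longrightarrow> partial_deriv i \<phi> x = 0" for x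
    using z z' K(2) by auto
  ultimately show "(LINT x:\<Omega>|lebesgue. u x * partial_deriv i \<phi> x) = - (LINT x:\<Omega>|lebesgue. partial_deriv i u x * \<phi> x)"
    by (simp add: set_integral_eq_integral)
qed

subsection \<open>A function of slow growth in the strip\<close>

text \<open>The integrand is at most 1 on \<open>{-1..1}\<close> and at most
  \<open>\<bar>x\<bar> powr (- 2 * \<tau>)\<close> outside, where the exponent is below -1.\<close>

lemma nn_integral_one_plus_square_powr_finite:
  assumes "\<tau> > 1 / 2"
  shows "(\<integral>\<^sup>+x. ennreal ((1 + x\<^sup>2) powr - \<tau>) \<partial>(lborel :: real measure)) < \<infinity>"
proof -
  define g where "g x = indicator {1..} x *\<^sub>R (x powr (- 2 * \<tau>))" for x :: real
  have hi: "((\<lambda>x. x powr (- 2 * \<tau>)) has_integral - (1 powr (- 2 * \<tau> + 1)) / (- 2 * \<tau> + 1)) {1..}"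
    by (rule has_integral_powr_to_inf) (use assms in auto)
  have "set_integrable lebesgue {1..} (\<lambda>x. x powr (- 2 * \<tau>))"
    by (rule nonnegative_absolutely_integrable_1) (use hi in \<open>auto simp: integrable_on_def\<close>)
  then have g: "integrable lborel g"
    by (simp add: set_integrable_def g_def[abs_def] integrable_completion)
  have g': "integrable lborel (\<lambda>x. g (- x))"
    using lborel_integrable_real_affine[OF g, of "-1" 0] by simp
  have i: "integrable lborel (\<lambda>x. indicator {-1..1} x + g x + g (- x))"
    using g g' by (intro Bochner_Integration.integrable_add) auto
  have "(1 + x\<^sup>2) powr - \<tau> \<le> indicator {-1..1} x + g x + g (- x)" for x
  proof (cases "\<bar>x\<bar> \<le> 1")
    case True
    have "(1 + x\<^sup>2) powr - \<tau> \<le> 1"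
      using assms powr_mono[of "-\<tau>" 0 "1 + x\<^sup>2"] by (simp split: if_splits)
    moreover have "g x \<ge> 0" "g (- x) \<ge> 0" by (auto simp: g_def)
    ultimately show ?thesis using True by (auto simp: abs_le_iff)
  next
    case False
    have "(1 + x\<^sup>2) powr - \<tau> \<le> (\<bar>x\<bar>\<^sup>2) powr - \<tau>"
      using assms False by (intro powr_mono2') auto
    also have "\<dots> = \<bar>x\<bar> powr (- 2 * \<tau>)"
    proof -
      have "\<bar>x\<bar>\<^sup>2 = \<bar>x\<bar> powr 2" using False by (simp add: powr_numeral)
      then show ?thesis by (simp only: powr_powr) simp
    qed
    also have "\<dots> \<le> indicator {-1..1} x + g x + g (- x)"
      using False by (auto simp: g_def abs_if indicator_def)
    finally show ?thesis .
  qed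
  then have "(\<integral>\<^sup>+x. ennreal ((1 + x\<^sup>2) powr - \<tau>) \<partial>lborel)
      \<le> (\<integral>\<^sup>+x. ennreal (norm (indicator {-1..1} x + g x + g (- x))) \<partial>lborel)"
    by (intro nn_integral_mono ennreal_leI) (metis abs_ge_self order_trans real_norm_def)
  also have "\<dots> < \<infinity>"
    using i by (simp add: integrable_iff_bounded)
  finally show ?thesis .
qed

text \<open>This is \<open>1 + |x'|^2\<close> for the coordinates \<open>x'\<close> other than
  \<open>k\<close>. The summand 1 keeps it away from zero, so its real powers are differentiable
  everywhere.\<close>

definition transverse_weight :: "'n \<Rightarrow> real ^ 'n \<Rightarrow> real" where
  "transverse_weight k x = 1 + (\<Sum>i\<in>UNIV - {k}. (x $ i)\<^sup>2)"

lemma transverse_weight_ge_1: "transverse_weight k x \<ge> 1"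
  by (simp add: transverse_weight_def sum_nonneg)

lemma transverse_weight_ge_square:
  assumes "i \<noteq> k" shows "1 + (x $ i)\<^sup>2 \<le> transverse_weight k x"
  using member_le_sum[of i "UNIV - {k}" "\<lambda>i. (x $ i)\<^sup>2"] assms
  by (simp add: transverse_weight_def)

lemma continuous_on_transverse_weight [continuous_intros]:
  "continuous_on S (transverse_weight k)"
  unfolding transverse_weight_def[abs_def] by (intro continuous_intros)

lemma borel_measurable_transverse_weight [measurable]:
  "transverse_weight k \<in> borel_measurable borel"
  by (intro borel_measurable_continuous_onI continuous_intros)

lemma nn_integral_lborel_prod_cart:
  fixes f :: "'n::finite \<Rightarrow> real \<Rightarrow> ennreal"
  assumes "\<And>i. f i \<in> borel_measurable borel"
  shows "(\<integral>\<^sup>+x. (\<Prod>i\<in>UNIV. f i (x $ i)) \<partial>lborel) = (\<Prod>i\<in>UNIV. \<integral>\<^sup>+t. f i t \<partial>lborel)"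
proof -
  \<comment> \<open>\<open>F\<close> moves the family from indices to basis vectors,
    \<open>THE\<close> recovering the index from \<open>axis i 1\<close>, so that the product
    formula over \<open>Basis\<close> applies.\<close>
  define F where "F b = f (THE i. b = axis i (1::real))" for b
  have F: "F (axis i 1) = f i" for i by (simp add: F_def axis_eq_axis)
  have B: "(Basis :: (real ^ 'n) set) = (\<lambda>i. axis i 1) ` UNIV" by (auto simp: Basis_vec_def)
  have inj: "inj (\<lambda>i. axis i (1::real) :: real ^ 'n)" by (auto simp: inj_def axis_eq_axis)
  have "(\<integral>\<^sup>+x. (\<Prod>b\<in>Basis. F b (x \<bullet> b)) \<partial>lborel) = (\<Prod>b\<in>Basis. \<integral>\<^sup>+t. F b t \<partial>lborel)"
    by (rule nn_integral_lborel_prod) (use assms in \<open>auto simp: F_def\<close>)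
  then show ?thesis
    by (simp add: B prod.reindex[OF inj] F inner_axis o_def)
qed

lemma open_strip: "open (strip k a b)"
  unfolding strip_def by (intro open_Collect_conj open_Collect_less continuous_intros)

lemma borel_strip [measurable]: "strip k a b \<in> sets borel"
  by (rule borel_open[OF open_strip])

text \<open>The weight dominates each factor \<open>1 + (x $ i)\<^sup>2\<close> with \<open>i \<noteq> k\<close>, hence also their geometric
  mean, which splits the integral into one-dimensional ones.\<close>

lemma transverse_weight_powr_integrable:
  fixes k :: "'n::finite"
  assumes "CARD('n) \<ge> 2" "\<sigma> > real (CARD('n) - 1) / 2"
  shows "integrable lborel (\<lambda>x. indicator (strip k a b) x *\<^sub>R transverse_weight k x powr - \<sigma>)"
proof -
  define d where "d = real (CARD('n) - 1)"
  have d: "d \<ge> 1" "\<sigma> > d / 2" using assms by (auto simp: d_def)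
  \<comment> \<open>The exponent is shared equally among the N - 1 transverse directions; the
    assumption on \<open>\<sigma>\<close> becomes the one-dimensional threshold 1/2.\<close>
  define \<tau> where "\<tau> = \<sigma> / d"
  have \<tau>: "\<tau> > 1 / 2" using d by (simp add: \<tau>_def field_simps)
  define f where "f i t = ennreal (if i = k then indicator {a<..<b} t else (1 + t\<^sup>2) powr - \<tau>)" for i :: 'n and t
  have fin: "(\<integral>\<^sup>+t. f i t \<partial>lborel) < \<infinity>" for i
  proof (cases "i = k")
    case True
    have "emeasure lborel {a<..<b} < \<infinity>" by (rule emeasure_bounded_finite) simp
    then show ?thesis using True by (simp add: f_def ennreal_indicator)
  next
    case False
    then show ?thesis using nn_integral_one_plus_square_powr_finite[OF \<tau>] by (simp add: f_def)
  qed
  have le: "ennreal (norm (indicator (strip k a b) x *\<^sub>R transverse_weight k x powr - \<sigma>)) \<le> (\<Prod>i\<in>UNIV. f i (x $ i))" for x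
  proof (cases "x \<in> strip k a b")
    case True
    have "transverse_weight k x powr - \<sigma> = (transverse_weight k x powr - \<tau>) ^ card (UNIV - {k})"
      using transverse_weight_ge_1[of k x] d
      by (simp add: powr_realpow[symmetric] powr_powr \<tau>_def d_def card_Diff_singleton)
    also have "\<dots> = (\<Prod>i\<in>UNIV - {k}. transverse_weight k x powr - \<tau>)" by simp
    also have "\<dots> \<le> (\<Prod>i\<in>UNIV - {k}. (1 + (x $ i)\<^sup>2) powr - \<tau>)"
      using \<tau> transverse_weight_ge_square[of _ k x]
      by (intro prod_mono conjI powr_mono2') (auto intro: add_pos_nonneg)
    finally have "ennreal (transverse_weight k x powr - \<sigma>) \<le> (\<Prod>i\<in>UNIV - {k}. f i (x $ i))"
      by (subst (asm) ennreal_le_iff[symmetric]) (auto simp: f_def prod_ennreal prod_nonneg)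
    also have "\<dots> = (\<Prod>i\<in>UNIV. f i (x $ i))"
      using True by (subst (2) prod.remove[of _ k]) (auto simp: f_def strip_def)
    finally show ?thesis using True by simp
  qed auto
  have "(\<integral>\<^sup>+x. ennreal (norm (indicator (strip k a b) x *\<^sub>R transverse_weight k x powr - \<sigma>)) \<partial>lborel)
     \<le> (\<integral>\<^sup>+x. (\<Prod>i\<in>UNIV. f i (x $ i)) \<partial>lborel)"
    by (intro nn_integral_mono le)
  also have "\<dots> = (\<Prod>i\<in>UNIV. \<integral>\<^sup>+t. f i t \<partial>lborel)"
    by (rule nn_integral_lborel_prod_cart) (simp add: f_def)
  also have "\<dots> < \<infinity>"
    using fin by (auto simp: less_top[symmetric] ennreal_prod_eq_top)
  finally show ?thesis
    by (intro integrableI_bounded) auto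
qed

section \<open>The non-extendable function and its gradient\<close>

text \<open>Dividing by \<open>\<alpha>\<close> cancels the factor from differentiation, so the
  derivative in a direction \<open>i \<noteq> k\<close> has the sign of \<open>x $ i\<close>,
  whatever the sign of \<open>\<alpha>\<close>.\<close>

definition power_profile :: "'n \<Rightarrow> real \<Rightarrow> real ^ 'n \<Rightarrow> real" where
  "power_profile k \<alpha> x = transverse_weight k x powr (\<alpha> / 2) / \<alpha>"

lemma transverse_weight_has_derivative:
  "(transverse_weight k has_derivative (\<lambda>h. \<Sum>i\<in>UNIV - {k}. 2 * (x $ i) * (h $ i))) (at x)"
  unfolding transverse_weight_def[abs_def]
  by (auto intro!: derivative_eq_intros has_derivative_component sum.cong simp: algebra_simps)

lemma power_profile_has_derivative:
  assumes "\<alpha> \<noteq> 0"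
  shows "(power_profile k \<alpha> has_derivative
    (\<lambda>h. (1 / 2) * transverse_weight k x powr (\<alpha> / 2 - 1) * (\<Sum>i\<in>UNIV - {k}. 2 * (x $ i) * (h $ i)))) (at x)"
proof -
  have "((\<lambda>q. q powr (\<alpha> / 2) / \<alpha>) has_real_derivative (1 / 2) * transverse_weight k x powr (\<alpha> / 2 - 1))
     (at (transverse_weight k x))"
    using transverse_weight_ge_1[of k x] assms
    by (auto intro!: derivative_eq_intros simp: powr_diff)
  from has_derivative_compose[OF transverse_weight_has_derivative this[unfolded has_field_derivative_def]]
  show ?thesis unfolding power_profile_def[abs_def] .
qed

lemma partial_deriv_power_profile:
  assumes "\<alpha> \<noteq> 0"
  shows "partial_deriv i (power_profile k \<alpha>) x =
    (if i = k then 0 else x $ i * transverse_weight k x powr (\<alpha> / 2 - 1))"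
  unfolding partial_deriv_eqI[OF power_profile_has_derivative[OF assms]]
  by (simp add: axis_def if_distrib sum.delta cong: if_cong)

lemma continuous_on_partial_deriv_power_profile:
  assumes "\<alpha> \<noteq> 0"
  shows "continuous_on UNIV (partial_deriv i (power_profile k \<alpha>))"
proof -
  have "transverse_weight k x \<noteq> 0" for x using transverse_weight_ge_1[of k x] by auto
  then have "continuous_on UNIV (\<lambda>x. if i = k then 0 else x $ i * transverse_weight k x powr (\<alpha> / 2 - 1))"
    by (cases "i = k") (auto intro!: continuous_intros)
  then show ?thesis by (subst partial_deriv_power_profile[OF assms, abs_def])
qed

text \<open>For \<open>i \<noteq> k\<close>, \<open>\<bar>x $ i\<bar>\<close> is at most the square
  root of the weight, which raises the exponent \<open>\<alpha> / 2 - 1\<close> by one half.\<close>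

lemma abs_partial_deriv_power_profile_le:
  assumes "\<alpha> \<noteq> 0"
  shows "\<bar>partial_deriv i (power_profile k \<alpha>) x\<bar> \<le> transverse_weight k x powr ((\<alpha> - 1) / 2)"
proof (cases "i = k")
  case False
  have Q: "transverse_weight k x > 0" using transverse_weight_ge_1[of k x] by simp
  have "\<bar>x $ i\<bar> = sqrt ((x $ i)\<^sup>2)" by simp
  also have "\<dots> \<le> sqrt (transverse_weight k x)"
    using transverse_weight_ge_square[OF False, of x] by (intro real_sqrt_le_mono) simp
  also have "\<dots> = transverse_weight k x powr (1 / 2)"
    using Q by (simp add: powr_half_sqrt)
  finally have "\<bar>x $ i * transverse_weight k x powr (\<alpha> / 2 - 1)\<bar>
    \<le> transverse_weight k x powr (1 / 2) * transverse_weight k x powr (\<alpha> / 2 - 1)"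
    by (simp add: abs_mult mult_right_mono)
  also have "\<dots> = transverse_weight k x powr ((\<alpha> - 1) / 2)"
    by (simp add: powr_add[symmetric] diff_divide_distrib)
  finally show ?thesis using False assms by (simp add: partial_deriv_power_profile)
qed (use assms in \<open>simp add: partial_deriv_power_profile\<close>)

lemma power_profile_differentiable: "\<alpha> \<noteq> 0 \<Longrightarrow> power_profile k \<alpha> differentiable (at x)"
  by (rule differentiableI[OF power_profile_has_derivative])

lemma power_profile_in_homogeneous_sobolev:
  fixes k :: "'n::finite" and \<alpha> p :: real
  assumes "CARD('n) \<ge> 2" "\<alpha> \<noteq> 0" "p > 0" "(1 - \<alpha>) * p > real (CARD('n) - 1)"
  shows "power_profile k \<alpha> \<in> homogeneous_sobolev p (strip k a b)"
proof -
  define G where "G x = (\<chi> i. partial_deriv i (power_profile k \<alpha>) x)" for x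
  have c: "continuous_on UNIV (\<lambda>x. G x $ i)" for i
    using continuous_on_partial_deriv_power_profile[OF assms(2)] by (simp add: G_def)
  have cu: "continuous_on UNIV (power_profile k \<alpha>)"
    by (intro differentiable_imp_continuous_on differentiable_at_imp_differentiable_on
        power_profile_differentiable assms(2))
  have "weak_gradient (strip k a b) (power_profile k \<alpha>) G"
    unfolding weak_gradient_def
  proof
    fix i
    show "weak_partial_deriv (strip k a b) i (power_profile k \<alpha>) (\<lambda>x. G x $ i)"
      using weak_partial_deriv_classical[OF power_profile_differentiable[OF assms(2)]
          continuous_on_partial_deriv_power_profile[OF assms(2)], of "strip k a b" i k]
      by (simp add: G_def)
  qed
  moreover have "(\<lambda>x. G x $ i) \<in> Lp_space p (strip k a b)" for i
  proof -
    have m [measurable]: "(\<lambda>x. G x $ i) \<in> borel_measurable borel"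
      by (rule borel_measurable_continuous_onI[OF c])
    \<comment> \<open>Half of the assumed inequality is the integrability threshold for the power of
      the weight that bounds \<open>\<bar>G x $ i\<bar> powr p\<close>.\<close>
    have "real (CARD('n) - 1) / 2 < (1 - \<alpha>) * p / 2"
      using assms(4) by simp
    note i = transverse_weight_powr_integrable[OF assms(1) this, of k a b]
    have "\<bar>G x $ i\<bar> powr p \<le> transverse_weight k x powr - ((1 - \<alpha>) * p / 2)" for x
    proof -
      have "\<bar>G x $ i\<bar> powr p \<le> (transverse_weight k x powr ((\<alpha> - 1) / 2)) powr p"
        using abs_partial_deriv_power_profile_le[OF assms(2), of i k x] assms(3)
        by (intro powr_mono2) (auto simp: G_def)
      also have "\<dots> = transverse_weight k x powr - ((1 - \<alpha>) * p / 2)"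
        by (simp add: powr_powr algebra_simps diff_divide_distrib)
      finally show ?thesis .
    qed
    then have "integrable lborel (\<lambda>x. indicator (strip k a b) x *\<^sub>R \<bar>G x $ i\<bar> powr p)"
      by (intro Bochner_Integration.integrable_bound[OF i] AE_I2) (auto simp: indicator_def)
    then have "set_integrable lebesgue (strip k a b) (\<lambda>x. \<bar>G x $ i\<bar> powr p)"
      by (simp add: set_integrable_def integrable_completion)
    moreover have "set_borel_measurable lebesgue (strip k a b) (\<lambda>x. G x $ i)"
      unfolding set_borel_measurable_def by (intro measurable_completion) simp
    ultimately show ?thesis by (simp add: Lp_space_def)
  qed
  ultimately show ?thesis
    using continuous_imp_L1_loc[OF cu] by (auto simp: homogeneous_sobolev_def)
qed

subsection \<open>Bump functions\<close>

lemma flat_nonneg: "flat 1 t \<ge> 0"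
  by (simp add: flat_def)

lemma flat_eq_0: "t \<le> 0 \<Longrightarrow> flat P t = 0"
  by (simp add: flat_def)

lemma flat_lower_bound: "0 < s \<Longrightarrow> s \<le> t \<Longrightarrow> exp (- (1 / s)) \<le> flat 1 t"
  by (auto simp: flat_def frac_le)

text \<open>The function vanishes for \<open>t \<le> 0\<close>, so compactness of
  \<open>{0..1}\<close> decides. The range \<open>t \<le> 1\<close> is the one in which
  \<open>ball_profile\<close> takes its values.\<close>

lemma flat_bounded: obtains M where "M \<ge> 0" "\<And>t. t \<le> 1 \<Longrightarrow> \<bar>flat P t\<bar> \<le> M"
proof -
  have "bounded (flat P ` {0..1})"
    by (intro compact_imp_bounded compact_continuous_image continuous_on_flat continuous_on_id) auto
  then obtain M where M: "\<And>t. t \<in> {0..1} \<Longrightarrow> \<bar>flat P t\<bar> \<le> M"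
    unfolding bounded_iff by (metis image_eqI real_norm_def)
  moreover have "M \<ge> 0" using M[of 0] by (auto intro: order_trans[OF abs_ge_zero])
  ultimately have "\<bar>flat P t\<bar> \<le> M" if "t \<le> 1" for t
    using that by (cases "t \<le> 0") (auto simp: flat_eq_0)
  with \<open>M \<ge> 0\<close> show ?thesis by (rule that)
qed

text \<open>Outside the interval of radius \<open>\<delta>\<close> about \<open>m\<close> the bump
  is zero and \<open>\<eta>\<close> is constant, so a bound on the compact interval holds
  everywhere.\<close>

lemma bounded_antiderivative_bump:
  assumes "\<delta> > 0"
  obtains \<eta> M where "\<And>t. (\<eta> has_real_derivative flat 1 (\<delta>\<^sup>2 - (t - m)\<^sup>2)) (at t)"
    "M \<ge> 0" "\<And>t. \<bar>\<eta> t\<bar> \<le> M"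
proof -
  define \<beta> where "\<beta> t = flat 1 (\<delta>\<^sup>2 - (t - m)\<^sup>2)" for t
  have "continuous_on UNIV \<beta>" unfolding \<beta>_def by (intro continuous_intros)
  then have "isCont \<beta> t" for t by (simp add: continuous_on_eq_continuous_at)
  from einterval_antiderivative[of "-\<infinity>" "\<infinity>" \<beta>, OF _ this]
  obtain \<eta> where \<eta>: "\<And>t. (\<eta> has_real_derivative \<beta> t) (at t)"
    by (auto simp: has_real_derivative_iff_has_vector_derivative)
  have c: "continuous_on S \<eta>" for S using \<eta> by (intro DERIV_continuous_on) (auto intro: DERIV_subset)
  have "bounded (\<eta> ` {m - \<delta>..m + \<delta>})"
    by (intro compact_imp_bounded compact_continuous_image c) auto
  then obtain M where M: "\<And>t. t \<in> {m - \<delta>..m + \<delta>} \<Longrightarrow> \<bar>\<eta> t\<bar> \<le> M"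
    unfolding bounded_iff by (metis image_eqI real_norm_def)
  have z: "\<beta> t = 0" if "\<bar>t - m\<bar> \<ge> \<delta>" for t
    using that assms abs_le_square_iff[of \<delta> "t - m"] by (simp add: \<beta>_def flat_eq_0)
  have "\<bar>\<eta> t\<bar> \<le> M" for t
  proof -
    consider "t < m - \<delta>" | "t > m + \<delta>" | "t \<in> {m - \<delta>..m + \<delta>}" by fastforce
    then show ?thesis
    proof cases
      case 1
      have "\<eta> (m - \<delta>) = \<eta> t"
        by (rule DERIV_isconst_end[OF 1 c]) (use \<eta> z in \<open>fastforce intro: DERIV_cong\<close>)
      then show ?thesis using M[of "m - \<delta>"] assms by simp
    next
      case 2
      have "\<eta> t = \<eta> (m + \<delta>)"
        by (rule DERIV_isconst_end[OF 2 c]) (use \<eta> z in \<open>fastforce intro: DERIV_cong\<close>)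
      then show ?thesis using M[of "m + \<delta>"] assms by simp
    qed (use M in auto)
  qed
  moreover have "M \<ge> 0" using M[of m] assms by (auto intro: order_trans[OF abs_ge_zero])
  ultimately show ?thesis using that \<eta> unfolding \<beta>_def by blast
qed

text \<open>For \<open>R > 0\<close> it is positive exactly on the open ball of radius
  \<open>R\<close> about \<open>R\<close> times \<open>c\<close>. Being polynomial, it turns into a
  smooth bump under \<open>flat 1\<close>.\<close>

definition ball_profile :: "real \<Rightarrow> real ^ 'n \<Rightarrow> real ^ 'n \<Rightarrow> real" where
  "ball_profile R c x = 1 - (\<Sum>i\<in>UNIV. (x $ i / R - c $ i)\<^sup>2)"

lemma C_k_ball_profile: "C_k n (ball_profile R c)"
proof -
  have "ball_profile R c = (\<lambda>x. 1 + (\<Sum>i\<in>UNIV. - 1 * ((x $ i * (1 / R) + - (c $ i)) * (x $ i * (1 / R) + - (c $ i)))))"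
    by (simp add: ball_profile_def[abs_def] power2_eq_square sum_negf)
  then show ?thesis
    by (simp only:) (intro C_k_add C_k_mult C_k_sum C_k_const C_k_component finite)
qed

lemma ball_profile_pos_imp:
  assumes "ball_profile R c x > 0"
  shows "\<bar>x $ i / R - c $ i\<bar> \<le> 1"
proof -
  have "(x $ i / R - c $ i)\<^sup>2 \<le> (\<Sum>i\<in>UNIV. (x $ i / R - c $ i)\<^sup>2)"
    by (rule member_le_sum) auto
  then show ?thesis using assms by (simp add: ball_profile_def abs_square_le_1[symmetric])
qed

lemma ball_profile_le_1: "ball_profile R c x \<le> 1"
  by (simp add: ball_profile_def sum_nonneg)

lemma ball_profile_support:
  assumes "R > 0" "x \<notin> cbox (\<chi> i. R * (c $ i - 1)) (\<chi> i. R * (c $ i + 1))"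
  shows "flat P (ball_profile R c x) = 0"
proof (rule ccontr)
  assume "flat P (ball_profile R c x) \<noteq> 0"
  then have "ball_profile R c x > 0" by (metis flat_eq_0 not_le)
  then have "\<bar>x $ i / R - c $ i\<bar> \<le> 1" for i by (rule ball_profile_pos_imp)
  then have "x \<in> cbox (\<chi> i. R * (c $ i - 1)) (\<chi> i. R * (c $ i + 1))"
    using assms(1) by (auto simp: mem_box_cart abs_le_iff field_simps)
  with assms(2) show False by simp
qed

text \<open>On the ball the last factor is at most \<open>2 / R\<close> in absolute value, so the
  bump has gradient of order \<open>1 / R\<close>. General \<open>P\<close> lets the formula serve
  again for second derivatives.\<close>

lemma partial_deriv_flat_ball_profile:
  "partial_deriv i (\<lambda>x. flat P (ball_profile R c x)) x =
     flat (flat_step P) (ball_profile R c x) * (- 2 / R * (x $ i / R - c $ i))"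
proof -
  have "(ball_profile R c has_derivative (\<lambda>h. \<Sum>i\<in>UNIV. (- 2 / R * (x $ i / R - c $ i)) * h $ i)) (at x)"
    unfolding ball_profile_def[abs_def] divide_inverse
    by (rule derivative_eq_intros has_derivative_component refl)+
      (simp add: sum_negf[symmetric] algebra_simps)
  from partial_deriv_eqI[OF has_derivative_compose[OF this flat_has_derivative[unfolded has_field_derivative_def]]]
  show ?thesis
    by (simp add: axis_def if_distrib sum.delta cong: if_cong)
qed

lemma partial_deriv_component_comp:
  assumes "\<And>t. (\<eta> has_real_derivative \<beta> t) (at t)"
  shows "(\<lambda>x. \<eta> (x $ k)) differentiable (at x)"
    and "partial_deriv i (\<lambda>x. \<eta> (x $ k)) x = (if i = k then \<beta> (x $ k) else 0)"
proof -
  have d: "((\<lambda>x. \<eta> (x $ k)) has_derivative (\<lambda>h. \<beta> (x $ k) * (h $ k))) (at x)"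
    using has_derivative_compose[OF has_derivative_component assms[unfolded has_field_derivative_def]] .
  show "(\<lambda>x. \<eta> (x $ k)) differentiable (at x)" by (rule differentiableI[OF d])
  show "partial_deriv i (\<lambda>x. \<eta> (x $ k)) x = (if i = k then \<beta> (x $ k) else 0)"
    by (simp add: partial_deriv_eqI[OF d] axis_def)
qed

subsection \<open>The obstruction to extension\<close>

text \<open>Test the \<open>k\<close>-derivative of \<open>v\<close> with
  \<open>\<eta> (x $ k) * partial_deriv j \<psi> x\<close>, the \<open>j\<close>-derivative with the
  same expression for \<open>partial_deriv k \<psi>\<close>, and subtract. The mixed second
  derivatives cancel, and only the term with the derivative \<open>\<beta>\<close> of
  \<open>\<eta>\<close> survives.\<close>

lemma curl_field_pairing:
  fixes v :: "real ^ 'n \<Rightarrow> real"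
  assumes v: "v \<in> L1_loc UNIV" and w: "weak_partial_deriv UNIV k v gk" "weak_partial_deriv UNIV j v gj"
    and "j \<noteq> k"
    and \<eta>: "\<And>t. (\<eta> has_real_derivative \<beta> t) (at t)" "\<And>n. C_k n (\<lambda>x::real^'n. \<beta> (x $ k))"
    and \<psi>: "\<And>n. C_k n \<psi>" and K: "compact K" "\<And>x. x \<notin> K \<Longrightarrow> \<psi> x = 0"
    and sym: "partial_deriv k (partial_deriv j \<psi>) = partial_deriv j (partial_deriv k \<psi>)"
  shows "(LINT x|lebesgue. v x * (\<beta> (x $ k) * partial_deriv j \<psi> x)) =
    (LINT x|lebesgue. gj x * (\<eta> (x $ k) * partial_deriv k \<psi> x)) -
    (LINT x|lebesgue. gk x * (\<eta> (x $ k) * partial_deriv j \<psi> x))"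
proof -
  have C\<eta>: "C_k n (\<lambda>x::real^'n. \<eta> (x $ k))" for n
    by (rule C_k_antiderivative_component[OF \<eta>])
  have C\<psi>': "C_k n (partial_deriv i \<psi>)" for n i
    using \<psi>[of "Suc n"] by simp
  have d\<psi>': "partial_deriv i \<psi> differentiable (at x)" for i x
    using C\<psi>'[of "Suc 0" i] by simp
  have z: "partial_deriv i \<psi> x = 0" if "x \<notin> K" for i x
    using partial_deriv_eq_0[OF compact_imp_closed[OF K(1)] K(2)] that by auto
  have T: "(\<lambda>x. \<eta> (x $ k) * partial_deriv i \<psi> x) \<in> test_functions UNIV" for i
    by (rule test_functionsI[OF _ K(1)]) (auto simp: z intro: C_k_mult C\<eta> C\<psi>')
  note dmult = partial_deriv_mult[OF partial_deriv_component_comp(1)[OF \<eta>(1)] d\<psi>']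
  \<comment> \<open>\<open>sym\<close> gives the second-order term the same form as in
    \<open>D2\<close>, ready for cancellation.\<close>
  have D1: "partial_deriv k (\<lambda>x. \<eta> (x $ k) * partial_deriv j \<psi> x) x =
      \<eta> (x $ k) * partial_deriv j (partial_deriv k \<psi>) x + \<beta> (x $ k) * partial_deriv j \<psi> x" for x
    using dmult by (simp add: sym partial_deriv_component_comp(2)[OF \<eta>(1)])
  have D2: "partial_deriv j (\<lambda>x. \<eta> (x $ k) * partial_deriv k \<psi> x) x =
      \<eta> (x $ k) * partial_deriv j (partial_deriv k \<psi>) x" for x
    using dmult \<open>j \<noteq> k\<close> by (simp add: partial_deriv_component_comp(2)[OF \<eta>(1)])
  have z2: "partial_deriv j (partial_deriv k \<psi>) x = 0" if "x \<notin> K" for x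
    using partial_deriv_eq_0[OF compact_imp_closed[OF K(1)] z] that by auto
  have c0: "continuous_on UNIV (\<lambda>x::real^'n. \<eta> (x $ k))" "continuous_on UNIV (\<lambda>x::real^'n. \<beta> (x $ k))"
    "continuous_on UNIV (partial_deriv j \<psi>)" "continuous_on UNIV (partial_deriv j (partial_deriv k \<psi>))"
    using C\<eta>[of 0] \<eta>(2)[of 0] C\<psi>'[of 0 j] C\<psi>'[of "Suc 0" k] by auto
  have i1: "integrable lebesgue (\<lambda>x. v x * (\<eta> (x $ k) * partial_deriv j (partial_deriv k \<psi>) x))"
    by (rule L1_loc_mult_integrable[OF v K(1)]) (auto simp: z2 intro!: continuous_on_mult c0)
  have i2: "integrable lebesgue (\<lambda>x. v x * (\<beta> (x $ k) * partial_deriv j \<psi> x))"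
    by (rule L1_loc_mult_integrable[OF v K(1)]) (auto simp: z intro!: continuous_on_mult c0)
  have "(LINT x|lebesgue. v x * (\<eta> (x $ k) * partial_deriv j (partial_deriv k \<psi>) x + \<beta> (x $ k) * partial_deriv j \<psi> x))
     = - (LINT x|lebesgue. gk x * (\<eta> (x $ k) * partial_deriv j \<psi> x))"
    using w(1) T[of j] by (auto simp: weak_partial_deriv_def D1 set_lebesgue_integral_def dest!: bspec)
  moreover have "(LINT x|lebesgue. v x * (\<eta> (x $ k) * partial_deriv j (partial_deriv k \<psi>) x))
     = - (LINT x|lebesgue. gj x * (\<eta> (x $ k) * partial_deriv k \<psi> x))"
    using w(2) T[of k] by (auto simp: weak_partial_deriv_def D2 set_lebesgue_integral_def dest!: bspec)
  ultimately show ?thesis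
    using i1 i2 by (simp add: distrib_left)
qed

text \<open>In place of Hoelder's inequality: \<open>\<bar>g\<bar> \<le> t powr (1 - p) * \<bar>g\<bar> powr p + t\<close> pointwise,
  with \<open>t\<close> to be optimised.\<close>

lemma abs_integral_mult_le:
  fixes g \<phi> :: "real ^ 'n \<Rightarrow> real"
  assumes g: "g \<in> L1_loc UNIV" "g \<in> Lp_space p UNIV" and p: "p > 1" and t: "t > 0"
    and \<phi>: "continuous_on UNIV \<phi>" "\<And>x. \<bar>\<phi> x\<bar> \<le> A" "\<And>x. x \<notin> cbox a b \<Longrightarrow> \<phi> x = 0"
  shows "\<bar>LINT x|lebesgue. g x * \<phi> x\<bar> \<le>
    A * (t powr (1 - p) * (LINT x|lebesgue. \<bar>g x\<bar> powr p) + t * measure lborel (cbox a b))"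
proof -
  have ip: "integrable lebesgue (\<lambda>x. \<bar>g x\<bar> powr p)"
    using g(2) by (simp add: Lp_space_def set_integrable_def)
  have i: "integrable lebesgue (\<lambda>x. g x * \<phi> x)"
    by (rule L1_loc_mult_integrable[OF g(1) compact_cbox _ \<phi>(1,3)]) auto
  have ib: "integrable lebesgue (indicator (cbox a b) :: real ^ 'n \<Rightarrow> real)"
    using emeasure_lborel_cbox_finite[of a b] by (intro integrable_real_indicator) auto
  have A: "A \<ge> 0" using \<phi>(2)[of 0] by (rule order_trans[OF abs_ge_zero])
  have young: "\<bar>y\<bar> \<le> t powr (1 - p) * \<bar>y\<bar> powr p + t" for y :: real
  proof (cases "\<bar>y\<bar> \<le> t")
    case False
    then have "1 \<le> (\<bar>y\<bar> / t) powr (p - 1)" using p t by (intro ge_one_powr_ge_zero) auto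
    then have "\<bar>y\<bar> * 1 \<le> \<bar>y\<bar> * (\<bar>y\<bar> / t) powr (p - 1)" by (intro mult_left_mono) auto
    also have "\<dots> = t powr (1 - p) * \<bar>y\<bar> powr p"
      using False t by (simp add: powr_divide powr_diff field_simps)
    finally show ?thesis using t by simp
  qed (use t in \<open>simp add: add_increasing\<close>)
  have "\<bar>LINT x|lebesgue. g x * \<phi> x\<bar> \<le> (LINT x|lebesgue. \<bar>g x * \<phi> x\<bar>)"
    by (rule integral_abs_bound)
  also have "\<dots> \<le> (LINT x|lebesgue. A * (t powr (1 - p) * \<bar>g x\<bar> powr p + t * indicator (cbox a b) x))"
  proof (rule integral_mono)
    fix x
    show "\<bar>g x * \<phi> x\<bar> \<le> A * (t powr (1 - p) * \<bar>g x\<bar> powr p + t * indicator (cbox a b) x)"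
    proof (cases "x \<in> cbox a b")
      case True
      have "\<bar>g x * \<phi> x\<bar> = \<bar>\<phi> x\<bar> * \<bar>g x\<bar>" by (simp add: abs_mult)
      also have "\<dots> \<le> A * (t powr (1 - p) * \<bar>g x\<bar> powr p + t)"
        by (intro mult_mono \<phi>(2) young A) auto
      finally show ?thesis using True by simp
    qed (use A \<phi>(3) in auto)
  qed (use i ip ib in auto)
  also have "\<dots> = A * (t powr (1 - p) * (LINT x|lebesgue. \<bar>g x\<bar> powr p) + t * measure lborel (cbox a b))"
    using ip ib by (simp add: measure_completion)
  finally show ?thesis .
qed

section \<open>Growth of the two sides under rescaling of the bump\<close>

text \<open>The value 2 forces \<open>x $ j \<ge> R\<close> for \<open>j \<noteq> k\<close> on the
  rescaled ball, which fixes the sign of the pairing with the gradient; the value 0 keeps the ball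
  over the support of the bump in \<open>x $ k\<close> as \<open>R\<close> grows.\<close>

definition probe_center :: "'n \<Rightarrow> real ^ 'n" where
  "probe_center k = (\<chi> i. if i = k then 0 else 2)"

text \<open>The integrand is nonnegative, so a box suffices: width \<open>\<delta>\<close> in
  direction \<open>k\<close>, width proportional to \<open>R\<close> in the others. There the
  integrand is at least of order \<open>R powr (\<alpha> - 1)\<close>, and the volume is of order
  \<open>R powr (N - 1)\<close>.\<close>

lemma probe_pairing_lower_bound:
  fixes j k :: "'n::finite" and \<alpha> \<delta> m :: real
  assumes "j \<noteq> k" "\<alpha> \<le> 2" "\<delta> > 0"
  obtains C R0 where "C > 0" "R0 \<ge> 1"
    "\<And>R. R \<ge> R0 \<Longrightarrow> C * R powr (real CARD('n) + \<alpha> - 2) \<le>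
      (LINT x|lebesgue. (x $ j * transverse_weight k x powr (\<alpha> / 2 - 1)) *
         (flat 1 (\<delta>\<^sup>2 - (x $ k - m)\<^sup>2) * flat 1 (ball_profile R (probe_center k) x)))"
proof -
  define N where "N = real CARD('n)"
  have N: "N \<ge> 1" by (simp add: N_def Suc_leI)
  \<comment> \<open>Small enough that \<open>N * \<tau>\<^sup>2 \<le> 1 / 2\<close>, which keeps the
    ball profile at least 1/2 on the box; there the transverse coordinates also lie between
    \<open>R\<close> and \<open>3 * R\<close>.\<close>
  define \<tau> where "\<tau> = 1 / (2 * N)"
  have \<tau>: "0 < \<tau>" "\<tau> \<le> 1 / 2" using N by (auto simp: \<tau>_def field_simps)
  \<comment> \<open>Values of \<open>flat 1\<close> at
    \<open>\<delta>\<^sup>2 - (\<delta> / 2)\<^sup>2\<close> and at 1/2, the lower bounds for the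
    two arguments on the box.\<close>
  define \<beta>0 \<epsilon>0 where "\<beta>0 = exp (- (1 / (3 * \<delta>\<^sup>2 / 4)))" and "\<epsilon>0 = exp (- (1 / (1 / 2 :: real)))"
  define C where "C = (10 * N) powr (\<alpha> / 2 - 1) * (\<beta>0 * \<epsilon>0) * (\<delta> * (2 * \<tau>) powr (N - 1))"
  \<comment> \<open>From here on the \<open>k\<close>-coordinate, bounded on the box by
    \<open>\<bar>m\<bar> + \<delta>\<close>, is at most \<open>\<tau>\<close> after division by
    \<open>R\<close>.\<close>
  define R0 where "R0 = max 1 ((\<bar>m\<bar> + \<delta>) / \<tau>)"
  have "C * R powr (N + \<alpha> - 2) \<le>
      (LINT x|lebesgue. (x $ j * transverse_weight k x powr (\<alpha> / 2 - 1)) *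
         (flat 1 (\<delta>\<^sup>2 - (x $ k - m)\<^sup>2) * flat 1 (ball_profile R (probe_center k) x)))" if "R \<ge> R0" for R
  proof -
    have R: "R \<ge> 1" "\<bar>m\<bar> + \<delta> \<le> \<tau> * R" "R > 0"
      using that \<tau> by (auto simp: R0_def field_simps)
    define F :: "real ^ 'n \<Rightarrow> real" where "F x = (x $ j * transverse_weight k x powr (\<alpha> / 2 - 1)) *
         (flat 1 (\<delta>\<^sup>2 - (x $ k - m)\<^sup>2) * flat 1 (ball_profile R (probe_center k) x))" for x
    have "continuous_on UNIV (ball_profile R (probe_center k))"
      using C_k_ball_profile[of 0] by simp
    moreover have "transverse_weight k x \<noteq> 0" for x using transverse_weight_ge_1[of k x] by auto
    ultimately have cF: "continuous_on UNIV F"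
      unfolding F_def by (intro continuous_intros) auto
    have "integrable lborel F"
      by (rule continuous_compact_support_integrable[OF cF compact_cbox[of
           "\<chi> i. R * (probe_center k $ i - 1)" "\<chi> i. R * (probe_center k $ i + 1)"]])
        (simp add: F_def ball_profile_support[OF R(3)])
    have F0: "F x \<ge> 0" for x
    proof (cases "ball_profile R (probe_center k) x > 0")
      case True
      from ball_profile_pos_imp[OF this, of j] have "x $ j / R \<ge> 1"
        using assms(1) by (simp add: probe_center_def abs_le_iff)
      then have "x $ j \<ge> 0" using R by (simp add: field_simps)
      then show ?thesis by (simp add: F_def flat_nonneg)
    qed (simp add: F_def flat_eq_0)
    define lo hi :: "real ^ 'n" where "lo = (\<chi> i. if i = k then m - \<delta> / 2 else (2 - \<tau>) * R)"
      and "hi = (\<chi> i. if i = k then m + \<delta> / 2 else (2 + \<tau>) * R)"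
    define \<kappa> where "\<kappa> = R * (10 * N * R\<^sup>2) powr (\<alpha> / 2 - 1) * (\<beta>0 * \<epsilon>0)"
    have lower: "\<kappa> \<le> F x" if "x \<in> cbox lo hi" for x
    proof -
      have box: "lo $ i \<le> x $ i" "x $ i \<le> hi $ i" for i
        using that by (auto simp: mem_box_cart)
      have xk: "\<bar>x $ k - m\<bar> \<le> \<delta> / 2"
        using box[of k] unfolding lo_def hi_def abs_le_iff by simp
      have xi: "\<bar>x $ i - 2 * R\<bar> \<le> \<tau> * R" if "i \<noteq> k" for i
        using box[of i] that unfolding lo_def hi_def by (simp add: abs_le_iff algebra_simps)
      have "(x $ k - m)\<^sup>2 \<le> (\<delta> / 2)\<^sup>2" using xk assms(3) by (intro power2_le_iff_abs_le[THEN iffD2]) auto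
      then have b: "\<beta>0 \<le> flat 1 (\<delta>\<^sup>2 - (x $ k - m)\<^sup>2)"
        unfolding \<beta>0_def using assms(3) by (intro flat_lower_bound) (auto simp: power2_eq_square)
      have "\<bar>x $ i / R - probe_center k $ i\<bar> \<le> \<tau>" for i
      proof (cases "i = k")
        case True
        have "\<bar>x $ k\<bar> \<le> \<tau> * R" using xk R assms(3) by linarith
        then show ?thesis using R True by (simp add: probe_center_def abs_divide field_simps)
      next
        case False
        have "x $ i / R - 2 = (x $ i - 2 * R) / R" using R by (simp add: field_simps)
        then show ?thesis using xi[OF False] R False by (simp add: probe_center_def abs_divide field_simps)
      qed
      then have "(x $ i / R - probe_center k $ i)\<^sup>2 \<le> \<tau>\<^sup>2" for i
        using \<tau> by (intro power2_le_iff_abs_le[THEN iffD2]) auto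
      then have "(\<Sum>i\<in>UNIV. (x $ i / R - probe_center k $ i)\<^sup>2) \<le> N * \<tau>\<^sup>2"
        unfolding N_def by (intro sum_bounded_above)
      also have "\<dots> \<le> 1 / 2" using \<tau> N by (simp add: \<tau>_def power2_eq_square field_simps)
      finally have "ball_profile R (probe_center k) x \<ge> 1 / 2" by (simp add: ball_profile_def)
      then have e: "\<epsilon>0 \<le> flat 1 (ball_profile R (probe_center k) x)"
        unfolding \<epsilon>0_def by (intro flat_lower_bound) auto
      have tR: "\<tau> * R \<le> R" using \<tau> R by (simp add: mult_left_le_one_le)
      have xj: "x $ j \<ge> R" using xi[OF assms(1)] tR by linarith
      have "(x $ i)\<^sup>2 \<le> 9 * R\<^sup>2" if "i \<in> UNIV - {k}" for i
      proof -
        have "\<bar>x $ i\<bar> \<le> 3 * R" using xi[of i] that tR by auto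
        then have "(x $ i)\<^sup>2 \<le> (3 * R)\<^sup>2" using R by (intro power2_le_iff_abs_le[THEN iffD2]) auto
        then show ?thesis by (simp add: power_mult_distrib)
      qed
      then have "(\<Sum>i\<in>UNIV - {k}. (x $ i)\<^sup>2) \<le> real (card (UNIV - {k})) * (9 * R\<^sup>2)"
        by (rule sum_bounded_above)
      also have "\<dots> \<le> N * (9 * R\<^sup>2)"
        by (intro mult_right_mono) (auto simp: N_def intro: card_mono)
      \<comment> \<open>Each transverse square is at most \<open>9 * R\<^sup>2\<close>; the
        remaining 1 is absorbed by one more \<open>N * R\<^sup>2\<close>, whence the factor
        10.\<close>
      finally have "transverse_weight k x \<le> 1 + N * (9 * R\<^sup>2)" by (simp add: transverse_weight_def)
      also have "1 \<le> N * R\<^sup>2" using N R mult_mono[of 1 N 1 "R\<^sup>2"] by simp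
      finally have "transverse_weight k x \<le> 10 * N * R\<^sup>2" by simp
      \<comment> \<open>The exponent is nonpositive because \<open>\<alpha> \<le> 2\<close>, so an
        upper bound for the weight is a lower bound for its power.\<close>
      then have q: "(10 * N * R\<^sup>2) powr (\<alpha> / 2 - 1) \<le> transverse_weight k x powr (\<alpha> / 2 - 1)"
        using transverse_weight_ge_1[of k x] assms(2) by (intro powr_mono2') auto
      show ?thesis
        unfolding \<kappa>_def F_def using b e q xj R
        by (intro mult_mono mult_nonneg_nonneg) (auto simp: \<beta>0_def \<epsilon>0_def flat_nonneg)
    qed
    have vol: "measure lborel (cbox lo hi) = \<delta> * (2 * \<tau> * R) powr (N - 1)"
    proof -
      have "lo $ i \<le> hi $ i" for i using \<tau> R assms(3) by (auto simp: lo_def hi_def mult_right_mono)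
      then have "cbox lo hi \<noteq> {}" by (simp add: interval_ne_empty_cart)
      then have "measure lborel (cbox lo hi) = (\<Prod>i\<in>UNIV. hi $ i - lo $ i)"
        by (simp add: content_cbox_cart)
      also have "\<dots> = \<delta> * (\<Prod>i\<in>UNIV - {k}. 2 * \<tau> * R)"
        by (subst prod.remove[of _ k]) (auto simp: lo_def hi_def algebra_simps intro!: prod.cong)
      also have "(\<Prod>i\<in>UNIV - {k}. 2 * \<tau> * R) = (2 * \<tau> * R) powr (N - 1)"
        using \<tau> R by (simp add: card_Diff_singleton N_def powr_realpow[symmetric] of_nat_diff Suc_leI)
      finally show ?thesis .
    qed
    have "C * R powr (N + \<alpha> - 2) = \<kappa> * measure lborel (cbox lo hi)"
    proof -
      have "(10 * N * R\<^sup>2) powr (\<alpha> / 2 - 1) = (10 * N) powr (\<alpha> / 2 - 1) * (R powr 2) powr (\<alpha> / 2 - 1)"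
        using N R by (simp add: powr_mult powr_numeral)
      also have "(R powr 2) powr (\<alpha> / 2 - 1) = R powr (\<alpha> - 2)"
        by (simp only: powr_powr) (simp add: algebra_simps)
      finally have 1: "(10 * N * R\<^sup>2) powr (\<alpha> / 2 - 1) = (10 * N) powr (\<alpha> / 2 - 1) * R powr (\<alpha> - 2)" .
      have 2: "(2 * \<tau> * R) powr (N - 1) = (2 * \<tau>) powr (N - 1) * R powr (N - 1)"
        using \<tau> R by (simp add: powr_mult)
      have "R powr (N + \<alpha> - 2) = R powr (1 + (\<alpha> - 2) + (N - 1))"
        by (simp add: algebra_simps)
      also have "\<dots> = R * R powr (\<alpha> - 2) * R powr (N - 1)"
        using R unfolding powr_add by simp
      finally show ?thesis unfolding C_def \<kappa>_def vol 1 2 by (simp add: mult_ac)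
    qed
    also have "\<dots> = (LINT x|lborel. \<kappa> * indicator (cbox lo hi) x)" by simp
    also have "\<dots> \<le> (LINT x|lborel. F x)"
    proof (rule integral_mono)
      show "integrable lborel (\<lambda>x. \<kappa> * indicator (cbox lo hi) x)"
        using emeasure_lborel_cbox_finite[of lo hi] by auto
      show "\<kappa> * indicator (cbox lo hi) x \<le> F x" for x
        using lower[of x] F0[of x] by (auto simp: indicator_def)
    qed fact
    also have "\<dots> = (LINT x|lebesgue. F x)"
      using cF by (simp add: integral_completion borel_measurable_continuous_onI)
    finally show ?thesis by (simp add: F_def)
  qed
  moreover have "C > 0" using N \<tau> assms(3) by (simp add: C_def \<beta>0_def \<epsilon>0_def)
  moreover have "R0 \<ge> 1" by (simp add: R0_def)
  ultimately show ?thesis using that[of C R0] by (simp add: N_def)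
qed

text \<open>The test function is of order \<open>1 / R\<close> and lives on a cube of volume of
  order \<open>R powr N\<close>; the \<open>p\<close>-integrability of \<open>g\<close> over the
  whole space saves the factor \<open>R powr (- N / p)\<close>.\<close>

lemma probe_pairing_upper_bound:
  fixes g :: "real ^ 'n \<Rightarrow> real"
  assumes g: "g \<in> L1_loc UNIV" "g \<in> Lp_space p UNIV" and p: "p > 1"
    and \<eta>: "continuous_on UNIV \<eta>" "\<And>t. \<bar>\<eta> t\<bar> \<le> M"
  obtains C where "C \<ge> 0" "\<And>R. R > 0 \<Longrightarrow>
    \<bar>LINT x|lebesgue. g x * (\<eta> (x $ k) * partial_deriv i (\<lambda>x. flat 1 (ball_profile R c x)) x)\<bar>
      \<le> C * R powr (real CARD('n) - real CARD('n) / p - 1)"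
proof -
  define N where "N = real CARD('n)"
  have M: "M \<ge> 0" using \<eta>(2)[of 0] by (rule order_trans[OF abs_ge_zero])
  obtain B where B: "B \<ge> 0" "\<And>t. t \<le> 1 \<Longrightarrow> \<bar>flat (flat_step 1) t\<bar> \<le> B"
    using flat_bounded by blast
  define I where "I = (LINT x|lebesgue. \<bar>g x\<bar> powr p)"
  have I: "I \<ge> 0" by (simp add: I_def)
  define C where "C = M * (2 * B) * (I + 2 powr N)"
  have "\<bar>LINT x|lebesgue. g x * (\<eta> (x $ k) * partial_deriv i (\<lambda>x. flat 1 (ball_profile R c x)) x)\<bar>
      \<le> C * R powr (N - N / p - 1)" if R: "R > 0" for R
  proof -
    define \<psi> where "\<psi> x = flat 1 (ball_profile R c x)" for x
    define lo hi where "lo = (\<chi> i. R * (c $ i - 1))" and "hi = (\<chi> i. R * (c $ i + 1))"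
    have C\<psi>: "C_k n \<psi>" for n
      unfolding \<psi>_def by (intro C_k_comp_flat C_k_ball_profile)
    have cont: "continuous_on UNIV (\<lambda>x. \<eta> (x $ k) * partial_deriv i \<psi> x)"
      using C\<psi>[of "Suc 0"]
      by (auto intro!: continuous_on_mult continuous_on_compose2[OF \<eta>(1)] continuous_intros)
    have d: "partial_deriv i \<psi> x = flat (flat_step 1) (ball_profile R c x) * (- 2 / R * (x $ i / R - c $ i))" for x
      unfolding \<psi>_def by (rule partial_deriv_flat_ball_profile)
    have d_le: "\<bar>partial_deriv i \<psi> x\<bar> \<le> 2 * B / R" for x
    proof (cases "ball_profile R c x > 0")
      case True
      have "\<bar>partial_deriv i \<psi> x\<bar> = \<bar>flat (flat_step 1) (ball_profile R c x)\<bar> * (2 / R * \<bar>x $ i / R - c $ i\<bar>)"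
        unfolding d abs_mult using R by simp
      also have "\<dots> \<le> B * (2 / R * 1)"
        using R B ball_profile_le_1 ball_profile_pos_imp[OF True]
        by (intro mult_mono mult_left_mono) auto
      finally show ?thesis by (simp add: mult_ac)
    qed (use R B in \<open>simp add: d flat_eq_0\<close>)
    have bd: "\<bar>\<eta> (x $ k) * partial_deriv i \<psi> x\<bar> \<le> M * (2 * B / R)" for x
      unfolding abs_mult by (intro mult_mono \<eta>(2) d_le M) auto
    have zero: "\<eta> (x $ k) * partial_deriv i \<psi> x = 0" if "x \<notin> cbox lo hi" for x
      using ball_profile_support[OF R] that by (auto simp: d lo_def hi_def)
    have vol: "measure lborel (cbox lo hi) = 2 powr N * R powr N"
    proof -
      have "cbox lo hi \<noteq> {}" using R by (auto simp: interval_ne_empty_cart lo_def hi_def)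
      then have "measure lborel (cbox lo hi) = (\<Prod>i\<in>UNIV. hi $ i - lo $ i)"
        by (simp add: content_cbox_cart)
      also have "\<dots> = (2 * R) ^ CARD('n)" by (simp add: lo_def hi_def algebra_simps)
      finally show ?thesis using R by (simp add: N_def powr_realpow power_mult_distrib)
    qed
    \<comment> \<open>This level balances the two terms: \<open>t powr (1 - p)\<close> and
      \<open>t * R powr N\<close> both equal \<open>R powr (N - N / p)\<close>.\<close>
    define t where "t = R powr (- N / p)"
    have t: "t > 0" using R by (simp add: t_def)
    have "- N / p * (1 - p) = N - N / p"
      using p by (simp add: field_simps)
    then have t1: "t powr (1 - p) = R powr (N - N / p)"
      unfolding t_def powr_powr by (rule arg_cong)
    have t2: "t * R powr N = R powr (N - N / p)"
      by (simp add: t_def powr_add[symmetric])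
    have "\<bar>LINT x|lebesgue. g x * (\<eta> (x $ k) * partial_deriv i \<psi> x)\<bar>
      \<le> M * (2 * B / R) * (t powr (1 - p) * I + t * measure lborel (cbox lo hi))"
      unfolding I_def by (rule abs_integral_mult_le[OF g p t cont bd zero])
    also have "\<dots> = M * (2 * B / R) * ((I + 2 powr N) * R powr (N - N / p))"
    proof -
      have "t * measure lborel (cbox lo hi) = 2 powr N * (t * R powr N)" by (simp add: vol mult_ac)
      then show ?thesis unfolding t1 t2 by (simp add: algebra_simps)
    qed
    also have "\<dots> = C * R powr (N - N / p - 1)"
      using R by (simp add: C_def powr_diff mult_ac)
    finally show ?thesis by (simp add: \<psi>_def[abs_def])
  qed
  moreover have "C \<ge> 0" using M B I by (simp add: C_def)
  ultimately show ?thesis using that[of C] by (simp add: N_def)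
qed

section \<open>Comparison of the growth rates and conclusion\<close>

lemma powr_growth_contradiction:
  fixes a b c C R0 :: real
  assumes "b < a" "c > 0" "C \<ge> 0" "\<And>R. R \<ge> R0 \<Longrightarrow> R \<ge> 1 \<Longrightarrow> c * R powr a \<le> C * R powr b"
  shows False
proof -
  \<comment> \<open>Large enough that \<open>R powr (a - b) \<ge> C / c + 1\<close>, which strictly
    exceeds \<open>C / c\<close>.\<close>
  define R where "R = max (max R0 1) ((C / c + 1) powr (1 / (a - b)))"
  have R: "R \<ge> R0" "R \<ge> 1" by (auto simp: R_def)
  have "C / c + 1 = ((C / c + 1) powr (1 / (a - b))) powr (a - b)"
    using assms by (simp add: powr_powr add_nonneg_pos)
  also have "\<dots> \<le> R powr (a - b)"
    using assms by (intro powr_mono2) (auto simp: R_def)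
  finally have "C < c * R powr (a - b)"
    using assms(2) by (simp add: field_simps)
  then have "C * R powr b < c * R powr (a - b) * R powr b"
    using R by (intro mult_strict_right_mono) auto
  also have "\<dots> = c * R powr a" by (simp add: powr_add[symmetric])
  finally show False using assms(4)[OF R] by simp
qed

lemma power_profile_not_extendable:
  fixes k :: "'n::finite" and \<alpha> p a b :: real
  assumes "CARD('n) \<ge> 2" "\<alpha> \<noteq> 0" "\<alpha> \<le> 2" "p > 1" "(1 - \<alpha>) * p < real CARD('n)" "a < b"
    and v: "v \<in> homogeneous_sobolev p UNIV" "is_extension (strip k a b) (power_profile k \<alpha>) v"
  shows False
proof -
  define N where "N = real CARD('n)"
  \<comment> \<open>The curl field needs a second direction besides \<open>k\<close>; dimension at
    least 2 supplies it.\<close>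
  obtain j where j: "j \<noteq> k"
  proof -
    have "UNIV \<noteq> {k}"
    proof
      assume "UNIV = {k}"
      from arg_cong[OF this, of card] show False using assms(1) by simp
    qed
    then show ?thesis using that by auto
  qed
  \<comment> \<open>A quarter of the width about the midpoint, so that the closed support of the
    bump stays inside the open strip.\<close>
  define m \<delta> where "m = (a + b) / 2" and "\<delta> = (b - a) / 4"
  have \<delta>: "\<delta> > 0" using assms(6) by (simp add: \<delta>_def)
  define \<beta> where "\<beta> t = flat 1 (\<delta>\<^sup>2 - (t - m)\<^sup>2)" for t
  have \<beta>0: "\<beta> (x $ k) = 0" if "x \<notin> strip k a b" for x :: "real ^ 'n"
  proof -
    have "\<bar>x $ k - m\<bar> \<ge> \<delta>"
      using that assms(6) by (auto simp: strip_def m_def \<delta>_def not_less abs_if field_simps)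
    then show ?thesis using \<delta> abs_le_square_iff[of \<delta> "x $ k - m"] by (simp add: \<beta>_def flat_eq_0)
  qed
  have C\<beta>: "C_k n (\<lambda>x::real^'n. \<beta> (x $ k))" for n
  proof -
    have "(\<lambda>x::real^'n. \<beta> (x $ k)) = (\<lambda>x. flat 1 (\<delta>\<^sup>2 + - 1 * ((x $ k + - m) * (x $ k + - m))))"
      by (simp add: \<beta>_def power2_eq_square)
    then show ?thesis
      by (simp only:) (intro C_k_comp_flat C_k_add C_k_mult C_k_const C_k_component)
  qed
  obtain \<eta> M where \<eta>: "\<And>t. (\<eta> has_real_derivative \<beta> t) (at t)" "M \<ge> 0" "\<And>t. \<bar>\<eta> t\<bar> \<le> M"
    unfolding \<beta>_def using bounded_antiderivative_bump[OF \<delta>] by blast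
  have c\<eta>: "continuous_on UNIV \<eta>" using \<eta>(1) by (intro DERIV_continuous_on) auto
  obtain G where v1: "v \<in> L1_loc UNIV" and G: "\<And>i. weak_partial_deriv UNIV i v (\<lambda>x. G x $ i)"
    "\<And>i. (\<lambda>x. G x $ i) \<in> Lp_space p UNIV"
    using v(1) by (auto simp: homogeneous_sobolev_def weak_gradient_def)
  have G1: "(\<lambda>x. G x $ i) \<in> L1_loc UNIV" for i using G(1) by (simp add: weak_partial_deriv_def)
  define u where "u = power_profile k \<alpha>"
  have du: "u differentiable (at x)" "continuous_on UNIV (partial_deriv i u)" for x i
    unfolding u_def using assms(2)
    by (rule power_profile_differentiable, intro continuous_on_partial_deriv_power_profile)
  have u1: "u \<in> L1_loc UNIV"
    by (intro continuous_imp_L1_loc differentiable_imp_continuous_on differentiable_at_imp_differentiable_on du)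
  define \<psi> where "\<psi> R x = flat 1 (ball_profile R (probe_center k) x)" for R and x :: "real ^ 'n"
  have C\<psi>: "C_k n (\<psi> R)" for n R
    unfolding \<psi>_def[abs_def] by (intro C_k_comp_flat C_k_ball_profile)
  \<comment> \<open>The left side of \<open>curl_field_pairing\<close> sees only values in the
    strip, where \<open>v\<close> may be replaced by \<open>u\<close>. One more integration by parts
    moves the \<open>j\<close>-derivative from the bump to \<open>u\<close>, giving the pairing
    already bounded from below.\<close>
  have identity: "- (LINT x|lebesgue. partial_deriv j u x * (\<beta> (x $ k) * \<psi> R x)) =
      (LINT x|lebesgue. G x $ j * (\<eta> (x $ k) * partial_deriv k (\<psi> R) x)) -
      (LINT x|lebesgue. G x $ k * (\<eta> (x $ k) * partial_deriv j (\<psi> R) x))" if R: "R > 0" for R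
  proof -
    define K where "K = cbox (\<chi> i. R * (probe_center k $ i - 1)) (\<chi> i. R * (probe_center k $ i + 1))"
    have K: "compact K" "\<And>x. x \<notin> K \<Longrightarrow> \<psi> R x = 0"
      using ball_profile_support[OF R] by (auto simp: K_def \<psi>_def)
    have z: "partial_deriv i (\<psi> R) x = 0" if "x \<notin> K" for i x
      using partial_deriv_eq_0[OF compact_imp_closed[OF K(1)] K(2)] that by auto
    have C\<psi>': "C_k n (partial_deriv i (\<psi> R))" for n i
      using C\<psi>[of "Suc n" R] by simp
    have pd: "partial_deriv i (\<psi> R) = (\<lambda>x. flat (flat_step 1) (ball_profile R (probe_center k) x) *
        (- 2 / R * (x $ i / R - probe_center k $ i)))" for i
      unfolding \<psi>_def[abs_def] by (rule ext, rule partial_deriv_flat_ball_profile)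
    \<comment> \<open>Checked from the explicit formula: for \<open>i \<noteq> i'\<close> the linear
      factor in \<open>x $ i'\<close> is constant in direction \<open>i\<close>, and the remaining
      product is symmetric in the two indices.\<close>
    have sym: "partial_deriv k (partial_deriv j (\<psi> R)) = partial_deriv j (partial_deriv k (\<psi> R))"
    proof
      fix x
      have "partial_deriv i (partial_deriv i' (\<psi> R)) x =
          flat (flat_step (flat_step 1)) (ball_profile R (probe_center k) x) *
          (- 2 / R * (x $ i / R - probe_center k $ i)) * (- 2 / R * (x $ i' / R - probe_center k $ i'))"
        if "i \<noteq> i'" for i i'
      proof -
        have l: "((\<lambda>x. - 2 / R * (x $ i' / R - probe_center k $ i')) has_derivative (\<lambda>h. - 2 / R * (h $ i' / R))) (at x)"
          unfolding divide_inverse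
          by (rule derivative_eq_intros has_derivative_component refl)+ simp
        have f: "(\<lambda>x. flat (flat_step 1) (ball_profile R (probe_center k) x)) differentiable (at x)"
          using C_k_comp_flat[OF C_k_ball_profile, of "Suc 0" "flat_step 1" R "probe_center k"] by simp
        show ?thesis
          unfolding pd partial_deriv_mult[OF f differentiableI[OF l]] partial_deriv_flat_ball_profile partial_deriv_eqI[OF l]
          using that by (simp add: axis_def)
      qed
      from this[of k j] this[of j k] j
      show "partial_deriv k (partial_deriv j (\<psi> R)) x = partial_deriv j (partial_deriv k (\<psi> R)) x" by simp
    qed
    have c0: "continuous_on UNIV (\<lambda>x. \<beta> (x $ k) * partial_deriv j (\<psi> R) x)"
      using C_k_mult[OF C\<beta>[of 0] C\<psi>'[of 0 j]] by simp
    have "(LINT x|lebesgue. u x * (\<beta> (x $ k) * partial_deriv j (\<psi> R) x)) =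
        - (LINT x|lebesgue. partial_deriv j u x * (\<beta> (x $ k) * \<psi> R x))"
    proof -
      have "(\<lambda>x. \<beta> (x $ k) * \<psi> R x) \<in> test_functions UNIV"
        by (rule test_functionsI[OF _ K(1)]) (auto simp: K(2) intro: C_k_mult C\<beta> C\<psi>)
      moreover have "partial_deriv j (\<lambda>x. \<beta> (x $ k) * \<psi> R x) x = \<beta> (x $ k) * partial_deriv j (\<psi> R) x" for x
      proof -
        have "partial_deriv j (\<lambda>x::real^'n. \<beta> (x $ k)) x = 0"
        proof -
          have "((\<beta>) has_real_derivative flat (flat_step 1) (\<delta>\<^sup>2 - (t - m)\<^sup>2) * (- 2 * (t - m))) (at t)" for t
            unfolding \<beta>_def[abs_def]
            by (rule DERIV_chain2[OF flat_has_derivative]) (auto intro!: derivative_eq_intros)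
          then show ?thesis using j by (subst partial_deriv_component_comp(2)) auto
        qed
        then show ?thesis
          using C\<beta>[of "Suc 0"] C\<psi>[of "Suc 0" R] by (simp add: partial_deriv_mult)
      qed
      ultimately show ?thesis
        using weak_partial_deriv_classical[OF du, of UNIV j]
        by (auto simp: weak_partial_deriv_def set_lebesgue_integral_def dest!: bspec)
    qed
    moreover have "(LINT x|lebesgue. v x * (\<beta> (x $ k) * partial_deriv j (\<psi> R) x)) =
        (LINT x|lebesgue. u x * (\<beta> (x $ k) * partial_deriv j (\<psi> R) x))"
    proof (rule integral_cong_AE)
      show "(\<lambda>x. v x * (\<beta> (x $ k) * partial_deriv j (\<psi> R) x)) \<in> borel_measurable lebesgue"
        by (intro borel_measurable_integrable L1_loc_mult_integrable[OF v1 K(1) _ c0]) (auto simp: z)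
      show "(\<lambda>x. u x * (\<beta> (x $ k) * partial_deriv j (\<psi> R) x)) \<in> borel_measurable lebesgue"
        by (intro borel_measurable_integrable L1_loc_mult_integrable[OF u1 K(1) _ c0]) (auto simp: z)
      \<comment> \<open>In the strip \<open>v\<close> and \<open>u\<close> agree almost everywhere;
        outside it \<open>\<beta> (x $ k)\<close> makes both sides zero.\<close>
      show "AE x in lebesgue. v x * (\<beta> (x $ k) * partial_deriv j (\<psi> R) x) =
          u x * (\<beta> (x $ k) * partial_deriv j (\<psi> R) x)"
        using v(2) unfolding is_extension_def by eventually_elim (use \<beta>0 in \<open>auto simp: u_def\<close>)
    qed
    ultimately show ?thesis
      using curl_field_pairing[OF v1 G(1) G(1) j \<eta>(1) C\<beta> C\<psi> K sym] by simp
  qed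
  obtain C1 where C1: "C1 \<ge> 0" "\<And>R. R > 0 \<Longrightarrow> \<bar>LINT x|lebesgue. G x $ j * (\<eta> (x $ k) * partial_deriv k (\<psi> R) x)\<bar>
      \<le> C1 * R powr (N - N / p - 1)"
    unfolding \<psi>_def[abs_def] N_def
    using probe_pairing_upper_bound[OF G1[of j] G(2)[of j] assms(4) c\<eta> \<eta>(3), of k k "probe_center k"] by blast
  obtain C2 where C2: "C2 \<ge> 0" "\<And>R. R > 0 \<Longrightarrow> \<bar>LINT x|lebesgue. G x $ k * (\<eta> (x $ k) * partial_deriv j (\<psi> R) x)\<bar>
      \<le> C2 * R powr (N - N / p - 1)"
    unfolding \<psi>_def[abs_def] N_def
    using probe_pairing_upper_bound[OF G1[of k] G(2)[of k] assms(4) c\<eta> \<eta>(3), of k j "probe_center k"] by blast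
  obtain C R0 where C: "C > 0" "R0 \<ge> 1" "\<And>R. R \<ge> R0 \<Longrightarrow> C * R powr (N + \<alpha> - 2) \<le>
      (LINT x|lebesgue. partial_deriv j u x * (\<beta> (x $ k) * \<psi> R x))"
    using probe_pairing_lower_bound[OF j assms(3) \<delta>, of m] j assms(2)
    by (auto simp: u_def partial_deriv_power_profile \<beta>_def \<psi>_def N_def)
  show False
  proof (rule powr_growth_contradiction)
    \<comment> \<open>After cancelling \<open>N\<close> and multiplying by \<open>p\<close> this is
      \<open>(1 - \<alpha>) * p < N\<close>.\<close>
    show "N - N / p - 1 < N + \<alpha> - 2"
      using assms(4,5) by (simp add: N_def field_simps)
    show "C > 0" "C1 + C2 \<ge> 0" using C C1 C2 by auto
    show "C * R powr (N + \<alpha> - 2) \<le> (C1 + C2) * R powr (N - N / p - 1)" if "R \<ge> R0" "R \<ge> 1" for R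
    proof -
      have "R > 0" using that by simp
      then show ?thesis
        using C(3)[OF that(1)] C1(2)[of R] C2(2)[of R] identity[of R] by (simp add: distrib_right abs_le_iff)
    qed
  qed
qed

theorem proposition4p1:
  fixes p bm bp :: real and k :: "'n::finite" and \<Omega> :: "(real ^ 'n) set"
  assumes "CARD('n) \<ge> 2" and "1 < p" and "bm < bp"
    and "\<Omega> = strip k bm bp"
  shows "(\<exists>u\<in>homogeneous_sobolev p \<Omega>. \<not> (\<exists>v\<in>homogeneous_sobolev p UNIV. is_extension \<Omega> u v))
       \<and> \<not> (\<exists>E. bounded_extension_operator p \<Omega> E)"
proof -
  define N where "N = real CARD('n)"
  have N: "N \<ge> 2" using assms(1) by (simp add: N_def)
  \<comment> \<open>\<open>s\<close> will be \<open>(1 - \<alpha>) * p\<close>: above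
    \<open>N - 1\<close> for integrability of the gradient over the strip, below \<open>N\<close>
    for the contradiction, and different from \<open>p\<close> to avoid \<open>\<alpha> = 0\<close>.
    If \<open>N - 1 / 2\<close> happens to be \<open>p\<close>, then \<open>N - 1 / 3\<close> is
    taken.\<close>
  obtain s where s: "N - 1 < s" "s < N" "s \<noteq> p"
  proof (cases "p = N - 1 / 2")
    case True
    then show ?thesis using that[of "N - 1 / 3"] by simp
  qed (use that[of "N - 1 / 2"] in simp)
  define \<alpha> where "\<alpha> = 1 - s / p"
  have "s / p \<ge> 0" using s N assms(2) by simp
  then have \<alpha>: "(1 - \<alpha>) * p = s" "\<alpha> \<noteq> 0" "\<alpha> \<le> 2"
    using s assms(2) by (auto simp: \<alpha>_def)
  have "power_profile k \<alpha> \<in> homogeneous_sobolev p \<Omega>"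
    unfolding assms(4) using assms s \<alpha> by (intro power_profile_in_homogeneous_sobolev) (auto simp: N_def of_nat_diff)
  moreover have "\<not> (\<exists>v\<in>homogeneous_sobolev p UNIV. is_extension \<Omega> (power_profile k \<alpha>) v)"
    using power_profile_not_extendable[OF assms(1) \<alpha>(2,3) assms(2) _ assms(3)] s \<alpha>(1)
    unfolding assms(4) by (auto simp: N_def)
  \<comment> \<open>An extension operator applied to this profile would produce an extension of
    it.\<close>
  ultimately show ?thesis
    unfolding bounded_extension_operator_def by blast
qed

end
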